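(* Let $T>0$, $\underline v>0$, $(x_0,\tilde x_0)\in\mathbb R^2$, $(v,\tilde v)\in L^\infty(\mathbb R;\mathbb R_{\ge\underline v})^2$ and $(\lambda,\tilde\lambda)\in L^\infty((0,T);W^{1,\infty}(\mathbb R))^2$. Then for all $t\in[0,T]$ the corresponding integral-sense solutions satisfy $$\begin{aligned} &\big|\mathcal X[v,\lambda](x_0;t)-\mathcal X[\tilde v,\tilde\lambda](\tilde x_0;t)\big|\\ &\le \|v\|_{L^\infty(\mathbb R)}e^{t\|v\|_{L^\infty(\mathbb R)}\mathcal L_2}\int_0^t\|\lambda(s,\cdot)-\tilde\lambda(s,\cdot)\|_{L^\infty(X(x_0,v,\lambda))}\,ds\\ &\quad+\Big(\|v\|_{L^\infty(\mathbb R)}e^{t\|v\|_{L^\infty(\mathbb R)}\mathcal L_2}\,t\,\mathcal L_2+1\Big)\frac{\|\tilde v\|_{L^\infty(\mathbb R)}}{\underline v}\Big(|x_0-\tilde x_0|+\frac1{\underline v}\|v-\tilde v\|_{L^1(Y(x_0,\tilde x_0,v,\mathcal L))}\Big), \end{aligned}$$ where $$\mathcal L_2:=\max\{\|\partial_2\lambda\|_{L^\infty((0,T);L^\infty(\mathbb R))},\|\partial_2\tilde\lambda\|_{L^\infty((0,T);L^\infty(\mathbb R))}\},$$ $$\mathcal L:=\max\{\|\lambda\|_{L^\infty((0,T);L^\infty(\mathbb R))},\|\tilde\lambda\|_{L^\infty((0,T);L^\infty(\mathbb R))}\},$$ $$Y(x_0,\tilde x_0,v,\mathcal L):=\Big(\min\{x_0-T\|v\|_{L^\infty(\mathbb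 R)}\mathcal L,\tilde x_0\},\ \max\{x_0+T\|v\|_{L^\infty(\mathbb R)}\mathcal L,\tilde x_0\}\Big),$$ $$X(x_0,v,\lambda):=x_0+T\|v\|_{L^\infty(\mathbb R)}\|\lambda\|_{L^\infty((0,T);L^\infty(\mathbb R))}\cdot(-1,1)\subset\mathbb R.$$
   Context: $L^\infty(\mathbb R;\mathbb R_{\ge\underline v})$ is the set of essentially bounded measurable functions on $\mathbb R$ with values in $[\underline v,\infty)$. $\partial_2\lambda$ is the derivative of $\lambda(t,x)$ with respect to $x$. $\mathcal X[v,\lambda](x_0;\cdot)$ denotes the unique function $x\in C([0,T])$ satisfying $$\int_{x_0}^{x(t)}\frac{1}{v(y)}\,dy=\int_0^t\lambda(s,x(s))\,ds\qquad\forall t\in[0,T],$$ i.e. the (integral-sense) solution of $x'(t)=v(x(t))\lambda(t,x(t))$, $x(0)=x_0$; it is known that it exists and is unique. Functions in $W^{1,\infty}(\mathbb R)$ are identified with their continuous representatives, and $\|\cdot\|_{L^\infty(X(x_0,v,\lambda))}$ of such functions is the supremum over $X(x_0,v,\lambda)$ (which is $\{x_0\}$ if $\lambda\equiv0$). *)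

theory Defs
  imports "HOL-Analysis.Analysis" "HOL-Probability.Essential_Supremum"
begin

section \<open>Lebesgue and Sobolev spaces on the line\<close>

text \<open>Elements of function spaces are represented by functions, not by their
  almost-everywhere equivalence classes.\<close>

definition Linf :: "real set \<Rightarrow> (real \<Rightarrow> real) set" where
  "Linf S = {f \<in> borel_measurable (lebesgue_on S). \<exists>C. AE x in lebesgue_on S. \<bar>f x\<bar> \<le> C}"

text \<open>The library's \<open>esssup\<close> is \<open>\<infinity>\<close> on non-measurable functions, so this real-valued norm is only
  meaningful on \<open>Linf S\<close>. If \<open>S\<close> is a null set, it is \<open>0\<close>.\<close>

definition Linf_norm :: "real set \<Rightarrow> (real \<Rightarrow> real) \<Rightarrow> real" where
  "Linf_norm S f = real_of_ereal (esssup (lebesgue_on S) (\<lambda>x. ereal \<bar>f x\<bar>))"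

definition Linf_ge :: "real \<Rightarrow> (real \<Rightarrow> real) set" where
  "Linf_ge c = {v \<in> Linf UNIV. AE x in lebesgue. c \<le> v x}"

definition L1_norm :: "real set \<Rightarrow> (real \<Rightarrow> real) \<Rightarrow> real" where
  "L1_norm S f = (LINT x:S|lebesgue. \<bar>f x\<bar>)"

definition test_function :: "(real \<Rightarrow> real) \<Rightarrow> bool" where
  "test_function \<phi> \<longleftrightarrow>
     (\<forall>n x. (deriv ^^ n) \<phi> differentiable at x) \<and> compact (closure {x. \<phi> x \<noteq> 0})"

definition has_weak_derivative :: "(real \<Rightarrow> real) \<Rightarrow> (real \<Rightarrow> real) \<Rightarrow> bool" where
  "has_weak_derivative f g \<longleftrightarrow>
     (\<forall>\<phi>. test_function \<phi> \<longrightarrow>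
        (LINT x|lebesgue. f x * deriv \<phi> x) = - (LINT x|lebesgue. g x * \<phi> x))"

text \<open>\<open>W\<^sup>1\<^sup>,\<^sup>\<infinity>(\<real>)\<close>, each class being represented by its continuous representative.\<close>

definition W1inf :: "(real \<Rightarrow> real) set" where
  "W1inf = {f \<in> Linf UNIV. continuous_on UNIV f \<and> (\<exists>g \<in> Linf UNIV. has_weak_derivative f g)}"

definition weak_deriv :: "(real \<Rightarrow> real) \<Rightarrow> real \<Rightarrow> real" where
  "weak_deriv f = (SOME g. g \<in> Linf UNIV \<and> has_weak_derivative f g)"

definition W1inf_norm :: "(real \<Rightarrow> real) \<Rightarrow> real" where
  "W1inf_norm f = Linf_norm UNIV f + Linf_norm UNIV (weak_deriv f)"

text \<open>\<open>L\<^sup>\<infinity>((0,T); W\<^sup>1\<^sup>,\<^sup>\<infinity>(\<real>))\<close>. Since \<open>W\<^sup>1\<^sup>,\<^sup>\<infinity>(\<real>)\<close> is not separable, strong measurability for its norm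
  would exclude such basic examples as \<open>\<lambda>(t,x) = a(x - t)\<close> with \<open>a\<close> Lipschitz but not \<open>C\<^sup>1\<close>.
  Measurability in time is therefore required after evaluation at each point \<open>x\<close>. As point
  evaluations are continuous on \<open>W\<^sup>1\<^sup>,\<^sup>\<infinity>(\<real>)\<close>, every strongly measurable map is included, too.
  Together with the continuity in \<open>x\<close>, this makes \<open>t \<mapsto> \<parallel>\<lambda>(t,\<cdot>)\<parallel>\<close> and \<open>t \<mapsto> \<parallel>\<partial>\<^sub>2\<lambda>(t,\<cdot>)\<parallel>\<close> (in \<open>L\<^sup>\<infinity>(\<real>)\<close>)
  measurable, as they are suprema of values, respectively of difference quotients, over
  rational points.\<close>

definition Linf_W1inf :: "real \<Rightarrow> (real \<Rightarrow> real \<Rightarrow> real) set" where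
  "Linf_W1inf T = {lam.
     (\<forall>x. (\<lambda>t. lam t x) \<in> borel_measurable (lebesgue_on {0<..<T})) \<and>
     (AE t in lebesgue_on {0<..<T}. lam t \<in> W1inf) \<and>
     (\<exists>C. AE t in lebesgue_on {0<..<T}. W1inf_norm (lam t) \<le> C)}"

definition Linf_Linf_norm :: "real \<Rightarrow> (real \<Rightarrow> real \<Rightarrow> real) \<Rightarrow> real" where
  "Linf_Linf_norm T lam = Linf_norm {0<..<T} (\<lambda>t. Linf_norm UNIV (lam t))"

definition partial2 :: "(real \<Rightarrow> real \<Rightarrow> real) \<Rightarrow> real \<Rightarrow> real \<Rightarrow> real" where
  "partial2 lam t = weak_deriv (lam t)"

text \<open>A genuine supremum: \<open>S\<close> may be a single point.\<close>

definition sup_norm_on :: "real set \<Rightarrow> (real \<Rightarrow> real) \<Rightarrow> real" where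
  "sup_norm_on S f = (SUP x\<in>S. \<bar>f x\<bar>)"

section \<open>Integral-sense solutions of \<open>x'(t) = v(x(t)) \<lambda>(t, x(t))\<close>, \<open>x(0) = x\<^sub>0\<close>\<close>

text \<open>Only the values of \<open>x\<close> on \<open>[0,T]\<close> matter. The integral over \<open>y\<close> is oriented.\<close>

definition integral_solution ::
  "real \<Rightarrow> (real \<Rightarrow> real) \<Rightarrow> (real \<Rightarrow> real \<Rightarrow> real) \<Rightarrow> real \<Rightarrow> (real \<Rightarrow> real) \<Rightarrow> bool" where
  "integral_solution T v lam x0 x \<longleftrightarrow>
     continuous_on {0..T} x \<and>
     (\<forall>t\<in>{0..T}. (LINT y=x0..x t|lebesgue. (1 / v y)) = (LINT s=0..t|lebesgue. lam s (x s)))"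

definition Lcal2 :: "real \<Rightarrow> (real \<Rightarrow> real \<Rightarrow> real) \<Rightarrow> (real \<Rightarrow> real \<Rightarrow> real) \<Rightarrow> real" where
  "Lcal2 T lam lam' = max (Linf_Linf_norm T (partial2 lam)) (Linf_Linf_norm T (partial2 lam'))"

definition Lcal :: "real \<Rightarrow> (real \<Rightarrow> real \<Rightarrow> real) \<Rightarrow> (real \<Rightarrow> real \<Rightarrow> real) \<Rightarrow> real" where
  "Lcal T lam lam' = max (Linf_Linf_norm T lam) (Linf_Linf_norm T lam')"

definition Yset :: "real \<Rightarrow> real \<Rightarrow> real \<Rightarrow> (real \<Rightarrow> real) \<Rightarrow> real \<Rightarrow> real set" where
  "Yset T x0 x0' v L =
     {min (x0 - T * Linf_norm UNIV v * L) x0' <..< max (x0 + T * Linf_norm UNIV v * L) x0'}"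

definition Xset :: "real \<Rightarrow> real \<Rightarrow> (real \<Rightarrow> real) \<Rightarrow> (real \<Rightarrow> real \<Rightarrow> real) \<Rightarrow> real set" where
  "Xset T x0 v lam = (\<lambda>r. x0 + T * Linf_norm UNIV v * Linf_Linf_norm T lam * r) ` {-1<..<1}"

end

theory Submission
  imports Defs
begin

text \<open>Let \<open>z\<close> be the point which the flow with speed \<open>v\<close> started at \<open>x\<^sub>0\<close> reaches in the
  \<open>1/v\<close>-time \<open>\<integral>\<^sub>0\<^sup>t \<lambda>'(s, x'(s)) ds\<close> of the second solution. Since \<open>1/v \<ge> 1/\<parallel>v\<parallel>\<close>, the distance
  \<open>\<bar>x(t) - z\<bar>\<close> is at most \<open>\<parallel>v\<parallel> \<integral>\<^sub>0\<^sup>t \<bar>\<lambda>(s, x(s)) - \<lambda>'(s, x'(s))\<bar> ds\<close>, and comparing \<open>1/v\<close> with \<open>1/v'\<close>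
  between \<open>x\<^sub>0\<close> and \<open>z\<close> bounds \<open>\<bar>z - x'(t)\<bar>\<close> by the data of the second summand. Gronwall's inequality
  and \<open>exp k \<le> 1 + k exp k\<close> conclude.

  The functional-analytic part is that \<open>f \<in> W\<^sup>1\<^sup>,\<^sup>\<infinity>\<close> is Lipschitz with optimal constant
  \<open>\<parallel>weak_deriv f\<parallel>\<close>: this gives the Lipschitz bound for \<open>\<lambda>'(s, \<cdot>)\<close>, and it makes the norms of \<open>\<lambda>(s, \<cdot>)\<close> and
  \<open>\<partial>\<^sub>2\<lambda>(s, \<cdot>)\<close> countable suprema, hence measurable in \<open>s\<close>. Measurability matters because \<open>Linf_norm\<close> of a
  non-measurable function is the junk value \<open>0\<close>.\<close>

section \<open>The essential supremum norm\<close>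

lemma Linf_AE_le_norm:
  assumes "f \<in> Linf S"
  shows "AE x in lebesgue_on S. \<bar>f x\<bar> \<le> Linf_norm S f"
proof -
  let ?M = "lebesgue_on S"
  let ?e = "esssup ?M (\<lambda>x. ereal \<bar>f x\<bar>)"
  from assms obtain C where m: "f \<in> borel_measurable ?M" and C: "AE x in ?M. \<bar>f x\<bar> \<le> C"
    by (auto simp: Linf_def)
  \<comment> \<open>Finiteness comes first, as \<open>real_of_ereal\<close> would turn \<infinity>
    into 0.\<close>
  have "?e \<le> ereal C"
    using m C by (intro esssup_I) auto
  then have fin: "?e \<noteq> \<infinity>" by auto
  show ?thesis
    using esssup_AE[where M="?M" and f="\<lambda>x. ereal \<bar>f x\<bar>"]
  proof eventually_elim
    case (elim x)
    with fin show ?case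
      unfolding Linf_norm_def by (cases ?e) auto
  qed
qed

text \<open>Without measurability of \<open>f\<close> the default values matter: a non-measurable
  \<open>f\<close> has essential supremum \<infinity>, and a negative essential supremum is possible
  only over a null set, where it is -\<infinity>. \<open>real_of_ereal\<close> sends both to
  0.\<close>

lemma Linf_norm_nonneg: "0 \<le> Linf_norm S f"
proof (cases "esssup (lebesgue_on S) (\<lambda>x. ereal \<bar>f x\<bar>) \<ge> 0")
  case True
  then show ?thesis by (simp add: Linf_norm_def real_of_ereal_pos)
next
  case False
  then have "AE x in lebesgue_on S. False"
    using esssup_AE[where M="lebesgue_on S" and f="\<lambda>x. ereal \<bar>f x\<bar>"]
    by (auto elim!: eventually_mono intro: order_trans[rotated])
  then have "AE x in lebesgue_on S. ereal \<bar>f x\<bar> \<le> c" for c by (rule eventually_mono) simp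
  then have "(\<lambda>x. ereal \<bar>f x\<bar>) \<in> borel_measurable (lebesgue_on S) \<Longrightarrow>
      esssup (lebesgue_on S) (\<lambda>x. ereal \<bar>f x\<bar>) \<le> -\<infinity>"
    by (intro esssup_I)
  then show ?thesis
    by (cases "(\<lambda>x. ereal \<bar>f x\<bar>) \<in> borel_measurable (lebesgue_on S)")
       (auto simp: Linf_norm_def esssup_non_measurable top_ereal_def)
qed

lemma Linf_norm_le:
  assumes "f \<in> borel_measurable (lebesgue_on S)" "AE x in lebesgue_on S. \<bar>f x\<bar> \<le> c" "0 \<le> c"
  shows "Linf_norm S f \<le> c"
proof -
  have "esssup (lebesgue_on S) (\<lambda>x. ereal \<bar>f x\<bar>) \<le> ereal c"
    using assms by (intro esssup_I) auto
  then show ?thesis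
    using assms(3) unfolding Linf_norm_def
    by (cases "esssup (lebesgue_on S) (\<lambda>x. ereal \<bar>f x\<bar>)") auto
qed

section \<open>Test functions\<close>

text \<open>The polynomial makes the family closed under differentiation: the derivative of p(1/y)
  exp(-1/y) belongs to the polynomial X^2 (p - p'). Exponential decay beats every polynomial in 1/y,
  so the gluing at 0 is smooth.\<close>

definition flat_exp :: "real poly \<Rightarrow> real \<Rightarrow> real" where
  "flat_exp p y = (if y > 0 then poly p (1 / y) * exp (- (1 / y)) else 0)"

lemma flat_exp_smult: "flat_exp (smult c q) y = flat_exp q y * c"
  by (simp add: flat_exp_def)

lemma poly_times_exp_tendsto_0: "((\<lambda>x::real. poly p x * exp (- x)) \<longlongrightarrow> 0) at_top"
proof -
  have "((\<lambda>x. \<Sum>i\<le>degree p. coeff p i * (x ^ i * exp (- x))) \<longlongrightarrow> (\<Sum>i\<le>degree p. coeff p i * 0)) at_top"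
  proof (intro tendsto_sum tendsto_mult tendsto_const)
    fix i show "((\<lambda>x::real. x ^ i * exp (- x)) \<longlongrightarrow> 0) at_top"
      using tendsto_power_div_exp_0[of i] by (simp add: exp_minus field_simps)
  qed
  then show ?thesis
    by (simp add: poly_altdef sum_distrib_right mult.assoc)
qed

lemma flat_exp_has_derivative:
  "(flat_exp p has_real_derivative flat_exp ([:0, 0, 1:] * (p - pderiv p)) y) (at y)"
proof -
  consider "y > 0" | "y < 0" | "y = 0" by linarith
  then show ?thesis
  proof cases
    case 1
    have "((\<lambda>y. poly p (1 / y) * exp (- (1 / y))) has_real_derivative
        flat_exp ([:0, 0, 1:] * (p - pderiv p)) y) (at y)"
      using 1 unfolding flat_exp_def
      by (auto intro!: derivative_eq_intros DERIV_chain'[where g="poly p"]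
          simp: field_simps power2_eq_square)
    then show ?thesis
      by (rule has_field_derivative_transform_within_open[where S="{0<..}"])
        (use 1 in \<open>auto simp: flat_exp_def\<close>)
  next
    case 2
    have "((\<lambda>y. 0) has_real_derivative flat_exp ([:0, 0, 1:] * (p - pderiv p)) y) (at y)"
      using 2 by (simp add: flat_exp_def)
    then show ?thesis
      by (rule has_field_derivative_transform_within_open[where S="{..<0}"])
        (use 2 in \<open>auto simp: flat_exp_def\<close>)
  next
    case 3
    \<comment> \<open>To the right of 0 the difference quotient is of the same type: division by
      \<open>h\<close> multiplies the polynomial by X, which gives \<open>pCons 0 p\<close>.\<close>
    have "((\<lambda>h. flat_exp p h / h) \<longlongrightarrow> 0) (at 0)"
    proof (rule filterlim_split_at)
      show "((\<lambda>h. flat_exp p h / h) \<longlongrightarrow> 0) (at_left 0)"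
        by (rule tendsto_eventually)
          (auto simp: flat_exp_def eventually_at_left_field intro!: exI[of _ "-1"])
      have "((\<lambda>h. poly (pCons 0 p) (inverse h) * exp (- inverse h)) \<longlongrightarrow> 0) (at_right (0::real))"
        by (rule filterlim_compose[OF poly_times_exp_tendsto_0 filterlim_inverse_at_top_right])
      then show "((\<lambda>h. flat_exp p h / h) \<longlongrightarrow> 0) (at_right 0)"
        by (rule Lim_transform_eventually)
          (auto simp: flat_exp_def eventually_at_right_field field_simps intro!: exI[of _ 1])
    qed
    then show ?thesis
      using 3 by (simp add: DERIV_def flat_exp_def)
  qed
qed

text \<open>A class closed under differentiation, so that differentiability of every order follows
  from first derivatives by induction. Scalar factors are absorbed into the polynomial of a
  generator.\<close>

inductive_set smooth_algebra :: "(real \<Rightarrow> real) set" where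
  flat: "(\<lambda>x. flat_exp p (c * x + d)) \<in> smooth_algebra"
| add: "f \<in> smooth_algebra \<Longrightarrow> g \<in> smooth_algebra \<Longrightarrow> (\<lambda>x. f x + g x) \<in> smooth_algebra"
| mult: "f \<in> smooth_algebra \<Longrightarrow> g \<in> smooth_algebra \<Longrightarrow> (\<lambda>x. f x * g x) \<in> smooth_algebra"

lemma smooth_algebra_has_derivative:
  assumes "f \<in> smooth_algebra"
  shows "\<exists>f'\<in>smooth_algebra. \<forall>x. (f has_real_derivative f' x) (at x)"
  using assms
proof induction
  case (flat p c d)
  let ?q = "[:0, 0, 1:] * (p - pderiv p)"
  have "((\<lambda>x. flat_exp p (c * x + d)) has_real_derivative flat_exp (smult c ?q) (c * x + d)) (at x)" for x
    unfolding flat_exp_smult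
    by (rule DERIV_chain2[OF flat_exp_has_derivative])
      (rule derivative_eq_intros refl | simp)+
  then show ?case
    by (intro bexI[of _ "\<lambda>x. flat_exp (smult c ?q) (c * x + d)"] smooth_algebra.flat allI)
next
  case (add f g)
  then obtain f' g' where "f' \<in> smooth_algebra" "g' \<in> smooth_algebra"
    "\<And>x. (f has_real_derivative f' x) (at x)" "\<And>x. (g has_real_derivative g' x) (at x)" by blast
  then show ?case
    by (intro bexI[of _ "\<lambda>x. f' x + g' x"] allI DERIV_add smooth_algebra.add)
next
  case (mult f g)
  then obtain f' g' where "f' \<in> smooth_algebra" "g' \<in> smooth_algebra"
    "\<And>x. (f has_real_derivative f' x) (at x)" "\<And>x. (g has_real_derivative g' x) (at x)" by blast
  with mult show ?case
    by (intro bexI[of _ "\<lambda>x. f' x * g x + g' x * f x"])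
       (intro allI DERIV_mult smooth_algebra.add smooth_algebra.mult; assumption)+
qed

lemma smooth_algebra_smooth:
  assumes "f \<in> smooth_algebra"
  shows "(deriv ^^ n) f differentiable at x"
proof -
  have "(deriv ^^ n) f \<in> smooth_algebra"
  proof (induction n)
    case (Suc n)
    then obtain f' where f': "f' \<in> smooth_algebra"
      "\<And>x. ((deriv ^^ n) f has_real_derivative f' x) (at x)"
      using smooth_algebra_has_derivative by blast
    then have "deriv ((deriv ^^ n) f) = f'"
      by (intro ext DERIV_imp_deriv)
    with f'(1) show ?case by (simp only: funpow.simps o_apply)
  qed (simp add: assms)
  from smooth_algebra_has_derivative[OF this] obtain f'
    where "\<forall>x. ((deriv ^^ n) f has_real_derivative f' x) (at x)" by blast
  then show ?thesis
    unfolding real_differentiable_def by (intro exI) (rule spec)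
qed

lemma smooth_algebra_continuous:
  assumes "f \<in> smooth_algebra" shows "continuous_on S f"
proof -
  obtain f' where "\<And>x. (f has_real_derivative f' x) (at x)"
    using smooth_algebra_has_derivative[OF assms] by blast
  then have "isCont f x" for x by (rule DERIV_isCont)
  then show ?thesis by (simp add: continuous_at_imp_continuous_on)
qed

text \<open>\<open>\<rho>\<close> is a multiple of exp(-1/x) exp(-1/(1-x)), extended by 0 outside
  (0,1), and \<open>P\<close> is its antiderivative, normalised to rise from 0 to 1. Membership in
  the algebra is stated for \<open>\<rho>\<close> in the rescaled form that the chain rule produces
  for P(cx+d), once for a rising and once for a falling flank; the higher derivatives of
  \<open>P\<close> are derivatives of \<open>\<rho>\<close>.\<close>

lemma smooth_step_exists:
  obtains P \<rho> :: "real \<Rightarrow> real" where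
    "\<And>x. (P has_real_derivative \<rho> x) (at x)"
    "\<And>c d. (\<lambda>x. c * \<rho> (c * x + d)) \<in> smooth_algebra"
    "\<And>c d. (\<lambda>x. - c * \<rho> (c * x + d)) \<in> smooth_algebra"
    "\<And>x. 0 \<le> \<rho> x" "\<And>x. x \<notin> {0..1} \<Longrightarrow> \<rho> x = 0"
    "\<And>x. x \<le> 0 \<Longrightarrow> P x = 0" "\<And>x. 1 \<le> x \<Longrightarrow> P x = 1" "\<And>x. P x \<in> {0..1}"
proof -
  define r where "r x = flat_exp 1 x * flat_exp 1 (1 - x)" for x
  have scaled: "(\<lambda>x. k * r (c * x + d)) \<in> smooth_algebra" for k c d
  proof -
    \<comment> \<open>The constant polynomial \<open>[:k:]\<close> supplies the factor
      \<open>k\<close>, and 1 - (cx + d) is again affine.\<close>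
    have "(\<lambda>x. flat_exp [:k:] (c * x + d) * flat_exp 1 ((-c) * x + (1 - d))) \<in> smooth_algebra"
      by (intro smooth_algebra.intros)
    also have "(\<lambda>x. flat_exp [:k:] (c * x + d) * flat_exp 1 ((-c) * x + (1 - d))) =
        (\<lambda>x. k * r (c * x + d))"
      by (auto simp: r_def flat_exp_def algebra_simps)
    finally show ?thesis .
  qed
  have r0: "0 \<le> r x" "x \<notin> {0..1} \<Longrightarrow> r x = 0" "0 < x \<Longrightarrow> x < 1 \<Longrightarrow> 0 < r x" for x
    by (auto simp: r_def flat_exp_def)
  have "isCont r x" for x
    using smooth_algebra_continuous[OF scaled[of 1 1 0], of UNIV]
    by (simp add: continuous_on_eq_continuous_at)
  then obtain F where F: "\<And>x. (F has_real_derivative r x) (at x)"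
    using einterval_antiderivative[of "-\<infinity>" \<infinity> r]
    by (auto simp: has_real_derivative_iff_has_vector_derivative)
  have mono: "F x \<le> F y" if "x \<le> y" for x y
    by (rule DERIV_nonneg_imp_nondecreasing[OF that]) (use F r0 in blast)
  have const: "F x = F y" if "x \<le> y" "\<And>z. x < z \<Longrightarrow> z < y \<Longrightarrow> r z = 0" for x y
  proof (cases "x = y")
    case False
    with that have "x < y" by simp
    from MVT2[OF this, of F r] F that(2) show ?thesis by fastforce
  qed auto
  have left: "F x = F 0" if "x \<le> 0" for x
    using that by (intro const r0(2)) auto
  have right: "F x = F 1" if "1 \<le> x" for x
    using that by (intro const[symmetric] r0(2)) auto
  have "F 0 < F 1"
  proof -
    obtain z where "0 < z" "z < 1" "F 1 - F 0 = (1 - 0) * r z"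
      using MVT2[of 0 1 F r] F by auto
    with r0(3)[of z] show ?thesis by simp
  qed
  define Z where "Z = F 1 - F 0"
  have Z: "Z > 0" using \<open>F 0 < F 1\<close> by (simp add: Z_def)
  show thesis
  proof (rule that[of "\<lambda>x. (F x - F 0) / Z" "\<lambda>x. r x / Z"])
    show "((\<lambda>x. (F x - F 0) / Z) has_real_derivative r x / Z) (at x)" for x
      using F[of x] Z by (auto intro!: derivative_eq_intros)
    show "(\<lambda>x. c * (r (c * x + d) / Z)) \<in> smooth_algebra" for c d
      using scaled[of "c / Z" c d] by simp
    show "(\<lambda>x. - c * (r (c * x + d) / Z)) \<in> smooth_algebra" for c d
      using scaled[of "- c / Z" c d] by simp
    show "(F x - F 0) / Z \<in> {0..1}" for x
    proof -
      have "F 0 \<le> F x" "F x \<le> F 1"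
        using mono[of 0 x] left[of x] mono[of x 1] right[of x] mono[of 0 1] by linarith+
      then show ?thesis using Z by (auto simp: Z_def divide_simps)
    qed
    show "(F x - F 0) / Z = 0" if "x \<le> 0" for x
      using left[OF that] by simp
    show "(F x - F 0) / Z = 1" if "1 \<le> x" for x
      using right[OF that] Z by (simp add: Z_def)
    show "0 \<le> r x / Z" for x
      using r0(1)[of x] Z by simp
    show "r x / Z = 0" if "x \<notin> {0..1}" for x
      using r0(2)[OF that] by simp
  qed
qed

section \<open>Weak derivatives\<close>

lemma Linf_UNIV_D:
  assumes "f \<in> Linf UNIV"
  shows "f \<in> borel_measurable lebesgue" "AE x in lebesgue. \<bar>f x\<bar> \<le> Linf_norm UNIV f"
  using assms Linf_AE_le_norm[OF assms] unfolding Linf_def lebesgue_on_UNIV_eq by blast+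

text \<open>The set where the bound fails is open and null, hence empty.\<close>

lemma continuous_AE_bound:
  fixes f :: "real \<Rightarrow> real"
  assumes "continuous_on UNIV f" "AE x in lebesgue. \<bar>f x\<bar> \<le> C"
  shows "\<bar>f x\<bar> \<le> C"
proof (rule ccontr)
  assume "\<not> \<bar>f x\<bar> \<le> C"
  then have "x \<in> {y. C < \<bar>f y\<bar>}" by simp
  moreover have "open {y. C < \<bar>f y\<bar>}"
    using assms(1) by (intro open_Collect_less continuous_intros)
  ultimately obtain e where "e > 0" and e: "ball x e \<subseteq> {y. C < \<bar>f y\<bar>}"
    unfolding open_contains_ball by blast
  then have "AE y in lebesgue. y \<notin> ball x e"
    using assms(2) by (auto elim!: eventually_mono)
  then have "negligible (ball x e)"
    by (simp add: negligible_iff_null_sets AE_iff_null_sets)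
  then show False
    using \<open>e > 0\<close> open_not_negligible[of "ball x e"] by simp
qed

lemma integrable_lebesgue_AE_bounded:
  fixes f :: "real \<Rightarrow> real"
  assumes f: "f \<in> borel_measurable lebesgue" "AE x in lebesgue. \<bar>f x\<bar> \<le> C"
    and S: "S \<in> lmeasurable"
  shows "set_integrable lebesgue S f"
  unfolding set_integrable_def
proof (rule Bochner_Integration.integrable_bound)
  show "integrable lebesgue (\<lambda>x. C * indicator S x)"
    using S by (intro integrable_mult_right integrable_real_indicator) (auto simp: fmeasurable_def)
  show "(\<lambda>x. indicat_real S x *\<^sub>R f x) \<in> borel_measurable lebesgue"
    using f S by (auto intro!: borel_measurable_scaleR)
  show "AE x in lebesgue. norm (indicat_real S x *\<^sub>R f x) \<le> norm (C * indicat_real S x)"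
    using f(2) by eventually_elim (auto simp: indicator_def)
qed

text \<open>The test functions are mollified indicators of \<open>{a<..b}\<close>; their derivatives are
  the differences of two approximate identities, concentrated at \<open>a\<close> and at \<open>b\<close>.\<close>

lemma weak_derivative_FTC:
  assumes f: "continuous_on UNIV f" "\<And>x. \<bar>f x\<bar> \<le> C"
    and g: "g \<in> Linf UNIV" and fg: "has_weak_derivative f g" and "a < b"
  shows "(LINT x:{a<..<b}|lebesgue. g x) = f b - f a"
proof -
  obtain P \<rho> :: "real \<Rightarrow> real" where
    deriv_P: "\<And>x. (P has_real_derivative \<rho> x) (at x)" and
    alg: "\<And>c d. (\<lambda>x. c * \<rho> (c * x + d)) \<in> smooth_algebra"
      "\<And>c d. (\<lambda>x. - c * \<rho> (c * x + d)) \<in> smooth_algebra" and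
    rho: "\<And>x. 0 \<le> \<rho> x" "\<And>x. x \<notin> {0..1} \<Longrightarrow> \<rho> x = 0" and
    P: "\<And>x. x \<le> 0 \<Longrightarrow> P x = 0" "\<And>x. 1 \<le> x \<Longrightarrow> P x = 1" "\<And>x. P x \<in> {0..1}"
    by (rule smooth_step_exists) blast
  \<comment> \<open>For large \<open>n\<close>, \<open>\<phi> n\<close> climbs from 0 to 1 just to
    the right of \<open>a\<close> and drops back just to the right of \<open>b\<close>, each time
    within length 1/(n+1). This is why the support lies in [a, b+1] and the limit is the indicator
    of the half-open interval.\<close>
  define \<phi> where "\<phi> n x = P (real (Suc n) * x + - real (Suc n) * a) - P (real (Suc n) * x + - real (Suc n) * b)" for n x
  define \<phi>' where "\<phi>' n x = real (Suc n) * \<rho> (real (Suc n) * x + - real (Suc n) * a) +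
    - real (Suc n) * \<rho> (real (Suc n) * x + - real (Suc n) * b)" for n x
  have der: "(\<phi> n has_real_derivative \<phi>' n x) (at x)" for n x
  proof -
    have "((\<lambda>x. P (c * x + d)) has_real_derivative \<rho> (c * x + d) * c) (at x)" for c d x
      by (rule DERIV_chain2[OF deriv_P]) (rule derivative_eq_intros refl | simp)+
    from DERIV_diff[OF this[of "real (Suc n)" "- real (Suc n) * a" x] this[of "real (Suc n)" "- real (Suc n) * b" x]]
    show ?thesis
      unfolding \<phi>_def \<phi>'_def by (simp add: algebra_simps)
  qed
  have "deriv (\<phi> n) = \<phi>' n" for n
    using der by (intro ext DERIV_imp_deriv)
  have in_alg: "\<phi>' n \<in> smooth_algebra" for n
    unfolding \<phi>'_def by (intro smooth_algebra.add alg)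
  have supp: "\<phi> n x = 0" if "x \<notin> {a..b+1}" for n x
  proof (cases "x < a")
    case True
    then have "real (Suc n) * x \<le> real (Suc n) * a" "real (Suc n) * x \<le> real (Suc n) * b"
      using \<open>a < b\<close> by (intro mult_left_mono; simp)+
    then show ?thesis by (simp add: \<phi>_def P(1) del: of_nat_Suc)
  next
    case False
    then have "1 \<le> x - a" "1 \<le> x - b" using that \<open>a < b\<close> by auto
    then have "1 * 1 \<le> real (Suc n) * (x - a)" "1 * 1 \<le> real (Suc n) * (x - b)"
      by (intro mult_mono; simp)+
    then show ?thesis by (simp add: \<phi>_def P(2) right_diff_distrib del: of_nat_Suc)
  qed
  have test: "test_function (\<phi> n)" for n
    unfolding test_function_def
  proof (intro conjI allI)
    fix k x
    show "(deriv ^^ k) (\<phi> n) differentiable at x"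
    proof (cases k)
      case 0
      then show ?thesis using der real_differentiable_def by auto
    next
      \<comment> \<open>It is \<open>\<phi>' n\<close> that lies in the algebra, so order 0 is
        treated separately and the innermost derivative is peeled off in all other orders.\<close>
      case (Suc m)
      have "(deriv ^^ k) (\<phi> n) = (deriv ^^ m) (\<phi>' n)"
        unfolding Suc by (simp only: funpow_Suc_right o_apply \<open>deriv (\<phi> n) = \<phi>' n\<close>)
      then show ?thesis using smooth_algebra_smooth[OF in_alg] by simp
    qed
    have "{x. \<phi> n x \<noteq> 0} \<subseteq> {a..b+1}"
      using supp[of _ n] by blast
    then have "bounded {x. \<phi> n x \<noteq> 0}"
      using bounded_subset bounded_closed_interval by blast
    then show "compact (closure {x. \<phi> n x \<noteq> 0})"
      by (simp add: compact_closure)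
  qed
  have parts: "(LINT x|lebesgue. f x * \<phi>' n x) = - (LINT x|lebesgue. g x * \<phi> n x)" for n
    using fg test[of n] unfolding has_weak_derivative_def \<open>deriv (\<phi> n) = \<phi>' n\<close>[symmetric] by blast
  note [measurable] = Linf_UNIV_D(1)[OF g]
  define G where "G = Linf_norm UNIV g"
  have G: "AE x in lebesgue. \<bar>g x\<bar> \<le> G" using Linf_UNIV_D(2)[OF g] by (simp add: G_def)

  have cont_rho: "continuous_on UNIV \<rho>"
    using smooth_algebra_continuous[OF alg(1)[of 1 0]] by simp
  then have [measurable]: "\<rho> \<in> borel_measurable borel"
    by (simp add: borel_measurable_continuous_onI)
  have [measurable]: "f \<in> borel_measurable borel"
    using f(1) by (simp add: borel_measurable_continuous_onI)
  have rho_int: "has_bochner_integral lborel \<rho> 1"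
  proof -
    have "has_bochner_integral lborel (\<lambda>x. \<rho> x * indicator {0..1} x) (P 1 - P 0)"
      by (rule has_bochner_integral_FTC_Icc_real)
        (use deriv_P cont_rho in \<open>auto simp: continuous_on_eq_continuous_at\<close>)
    also have "(\<lambda>x. \<rho> x * indicator {0..1} x) = \<rho>"
    proof
      fix x show "\<rho> x * indicator {0..1} x = \<rho> x"
        using rho(2)[of x] by (cases "x \<in> {0..1}") simp_all
    qed
    finally show ?thesis by (simp add: P)
  qed
  \<comment> \<open>\<open>\<rho>\<close> has integral 1, so these are averages of \<open>f\<close>
    over points tending to \<open>c\<close>.\<close>
  have conc: "(\<lambda>n. LINT x|lborel. f (c + x / real (Suc n)) * \<rho> x) \<longlonglongrightarrow> f c" for c
  proof -
    have "(\<lambda>n. LINT x|lborel. f (c + x / real (Suc n)) * \<rho> x) \<longlonglongrightarrow> (LINT x|lborel. f c * \<rho> x)"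
    proof (rule integral_dominated_convergence[where w="\<lambda>x. C * \<rho> x"])
      show "AE x in lborel. (\<lambda>n. f (c + x / real (Suc n)) * \<rho> x) \<longlonglongrightarrow> f c * \<rho> x"
      proof (intro AE_I2 tendsto_mult tendsto_const)
        fix x
        have "(\<lambda>n. c + x / real (Suc n)) \<longlonglongrightarrow> c + 0"
          by (intro tendsto_add tendsto_const LIMSEQ_Suc[OF lim_const_over_n])
        moreover have "isCont f c" using f(1) by (simp add: continuous_on_eq_continuous_at)
        ultimately show "(\<lambda>n. f (c + x / real (Suc n))) \<longlonglongrightarrow> f c"
          by (intro isCont_tendsto_compose[of c f]) auto
      qed
      show "integrable lborel (\<lambda>x. C * \<rho> x)"
        using rho_int by (auto simp: has_bochner_integral_iff)
      show "AE x in lborel. norm (f (c + x / real (Suc n)) * \<rho> x) \<le> C * \<rho> x" for n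
        by (intro AE_I2) (auto simp: abs_mult rho(1) intro!: mult_right_mono f(2))
    qed measurable
    then show ?thesis using rho_int by (simp add: has_bochner_integral_iff)
  qed
  \<comment> \<open>The substitution of (n+1)(x - c) for the variable cancels the factor n+1 and
    turns the integral against one flank into an average as in \<open>conc\<close>.\<close>
  have shift: "has_bochner_integral lborel
      (\<lambda>x. f x * (real (Suc n) * \<rho> (real (Suc n) * x + - real (Suc n) * c)))
      (LINT x|lborel. f (c + x / real (Suc n)) * \<rho> x)" for n c
  proof -
    have "integrable lborel (\<lambda>x. f (c + x / real (Suc n)) * \<rho> x)"
    proof (rule Bochner_Integration.integrable_bound)
      show "integrable lborel (\<lambda>x. C * \<rho> x)"
        using rho_int by (auto simp: has_bochner_integral_iff)
      show "AE x in lborel. norm (f (c + x / real (Suc n)) * \<rho> x) \<le> norm (C * \<rho> x)"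
        using order_trans[OF abs_ge_zero f(2)]
        by (intro AE_I2) (auto simp: abs_mult rho(1) intro!: mult_right_mono f(2))
    qed measurable
    then have "has_bochner_integral lborel (\<lambda>x. f (c + x / real (Suc n)) * \<rho> x)
        (LINT x|lborel. f (c + x / real (Suc n)) * \<rho> x)"
      by (simp add: has_bochner_integral_iff)
    then have "has_bochner_integral lborel
      (\<lambda>x. f (c + (- real (Suc n) * c + real (Suc n) * x) / real (Suc n)) * \<rho> (- real (Suc n) * c + real (Suc n) * x))
      ((LINT x|lborel. f (c + x / real (Suc n)) * \<rho> x) /\<^sub>R \<bar>real (Suc n)\<bar>)"
      by (rule lborel_has_bochner_integral_real_affine_iff[THEN iffD1, rotated]) simp
    from has_bochner_integral_mult_right[OF this, of "real (Suc n)"] show ?thesis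
      by (simp add: field_simps del: of_nat_Suc)
  qed
  have "(LINT x|lebesgue. f x * \<phi>' n x) =
      (LINT x|lborel. f (a + x / real (Suc n)) * \<rho> x) - (LINT x|lborel. f (b + x / real (Suc n)) * \<rho> x)" for n
  proof -
    have "has_bochner_integral lborel (\<lambda>x. f x * \<phi>' n x)
      ((LINT x|lborel. f (a + x / real (Suc n)) * \<rho> x) - (LINT x|lborel. f (b + x / real (Suc n)) * \<rho> x))"
      using has_bochner_integral_diff[OF shift[of n a] shift[of n b]]
      unfolding \<phi>'_def by (simp add: algebra_simps del: of_nat_Suc)
    then have "(LINT x|lborel. f x * \<phi>' n x) =
      (LINT x|lborel. f (a + x / real (Suc n)) * \<rho> x) - (LINT x|lborel. f (b + x / real (Suc n)) * \<rho> x)"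
      by (simp add: has_bochner_integral_iff)
    moreover have "(\<lambda>x. f x * \<phi>' n x) \<in> borel_measurable lborel"
      unfolding \<phi>'_def by measurable
    ultimately show ?thesis by (simp add: integral_completion)
  qed
  then have "(\<lambda>n. LINT x|lebesgue. f x * \<phi>' n x) \<longlonglongrightarrow> f a - f b"
    using tendsto_diff[OF conc[of a] conc[of b]] by simp

  \<comment> \<open>The other side of the weak formulation: \<open>\<phi> n\<close> converges
    pointwise, and its modulus is at most 1 on [a, b+1] and 0 elsewhere, so that convergence is
    dominated.\<close>
  moreover have "(\<lambda>n. LINT x|lebesgue. g x * \<phi> n x) \<longlonglongrightarrow> (LINT x|lebesgue. g x * indicator {a<..b} x)"
  proof (rule integral_dominated_convergence[where w="\<lambda>x. G * indicator {a..b+1} x"])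
    have "isCont (\<phi> n) x" for n x using der by (rule DERIV_isCont)
    then have "\<phi> n \<in> borel_measurable borel" for n
      by (intro borel_measurable_continuous_onI continuous_at_imp_continuous_on) auto
    then have [measurable]: "\<phi> n \<in> borel_measurable lebesgue" for n
      using measurable_completion[of "\<phi> n" lborel borel] by simp
    show "(\<lambda>x. g x * \<phi> n x) \<in> borel_measurable lebesgue" for n by measurable
    have "{a<..b} \<in> sets lebesgue" by simp
    then show "(\<lambda>x. g x * indicat_real {a<..b} x) \<in> borel_measurable lebesgue" by measurable
    show "integrable lebesgue (\<lambda>x. G * indicat_real {a..b+1} x)"
      by (intro integrable_mult_right integrable_real_indicator) (auto simp: emeasure_lborel_Icc_eq)
    show "AE x in lebesgue. norm (g x * \<phi> n x) \<le> G * indicator {a..b+1} x" for n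
      using G
    proof eventually_elim
      case (elim x)
      show ?case
      proof (cases "x \<in> {a..b+1}")
        case True
        have "\<bar>\<phi> n x\<bar> \<le> 1"
          using P(3)[of "real (Suc n) * x + - real (Suc n) * a"]
            P(3)[of "real (Suc n) * x + - real (Suc n) * b"]
          unfolding \<phi>_def atLeastAtMost_iff by linarith
        then have "\<bar>g x\<bar> * \<bar>\<phi> n x\<bar> \<le> G * 1"
          using elim by (intro mult_mono) auto
        with True show ?thesis by (simp add: abs_mult)
      qed (simp add: supp)
    qed
    show "AE x in lebesgue. (\<lambda>n. g x * \<phi> n x) \<longlonglongrightarrow> g x * indicator {a<..b} x"
    proof (intro AE_I2 tendsto_mult tendsto_const)
      fix x
      have lim: "(\<lambda>n. P (real (Suc n) * x + - real (Suc n) * c)) \<longlonglongrightarrow> (if x \<le> c then 0 else 1)" for c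
      proof (cases "x \<le> c")
        case True
        then have "real (Suc n) * x \<le> real (Suc n) * c" for n
          by (intro mult_left_mono) auto
        then show ?thesis using True by (simp add: P(1) del: of_nat_Suc)
      next
        case False
        then obtain N :: nat where N: "1 / (x - c) < real N" using reals_Archimedean2 by blast
        have "P (real (Suc n) * x + - real (Suc n) * c) = 1" if "n \<ge> N" for n
        proof (rule P(2))
          have "1 / (x - c) \<le> real (Suc n)" using N that by linarith
          then show "1 \<le> real (Suc n) * x + - real (Suc n) * c"
            using False by (simp add: field_simps del: of_nat_Suc)
        qed
        then show ?thesis
          using False by (intro tendsto_eventually eventually_sequentiallyI[of N]) simp
      qed
      have "(if x \<le> a then 0 else 1) - (if x \<le> b then 0 else 1) = indicat_real {a<..b} x"
        using \<open>a < b\<close> by (auto simp: indicator_def)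
      then show "(\<lambda>n. \<phi> n x) \<longlonglongrightarrow> indicat_real {a<..b} x"
        using tendsto_diff[OF lim[of a] lim[of b]] unfolding \<phi>_def by simp
    qed
  qed
  ultimately have "f a - f b = - (LINT x|lebesgue. g x * indicator {a<..b} x)"
    unfolding parts by (metis LIMSEQ_unique tendsto_minus)
  moreover have "(LINT x:{a<..<b}|lebesgue. g x) = (LINT x:{a<..b}|lebesgue. g x)"
    by (rule set_integral_discrete_difference[where X="{b}"]) auto
  ultimately show ?thesis
    by (simp add: set_lebesgue_integral_def mult.commute)
qed

section \<open>From integrals over intervals to almost every point\<close>

lemma set_integral_bounds:
  fixes h :: "real \<Rightarrow> real"
  assumes h: "h \<in> borel_measurable lebesgue" "AE y in lebesgue. \<bar>h y\<bar> \<le> C"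
    and S: "S \<in> lmeasurable"
  shows "\<bar>LINT y:S|lebesgue. h y\<bar> \<le> C * measure lebesgue S"
proof -
  have int: "set_integrable lebesgue S h"
    by (rule integrable_lebesgue_AE_bounded[OF h S])
  have C: "integrable lebesgue (\<lambda>y. C * indicator S y)" "(LINT y|lebesgue. C * indicator S y) = C * measure lebesgue S"
    using S by (auto simp: fmeasurable_def intro!: integrable_mult_right integrable_real_indicator)
  have "\<bar>LINT y:S|lebesgue. h y\<bar> \<le> (LINT y|lebesgue. norm (indicator S y *\<^sub>R h y))"
    unfolding set_lebesgue_integral_def using integral_norm_bound by fastforce
  also have "\<dots> \<le> (LINT y|lebesgue. C * indicator S y)"
    using int h(2) C(1) unfolding set_integrable_def
    by (intro integral_mono_AE integrable_norm) (auto elim!: eventually_mono simp: indicator_def)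
  finally show ?thesis using C(2) by simp
qed

text \<open>\<open>A\<close> is covered, up to measure \<open>\<delta>\<close>, by countably many
  non-overlapping compact intervals. The integral over their union is a limit of finite sums of
  interval integrals, hence non-negative, and the excess over \<open>A\<close> contributes at most C
  \<delta>.\<close>

lemma set_integral_nonneg_if_intervals:
  fixes h :: "real \<Rightarrow> real"
  assumes h: "h \<in> borel_measurable lebesgue" "AE y in lebesgue. \<bar>h y\<bar> \<le> C"
    and int_nonneg: "\<And>a b. a < b \<Longrightarrow> 0 \<le> (LINT y:{a<..<b}|lebesgue. h y)"
    and A: "A \<in> lmeasurable" "A \<subseteq> cbox a b" and "0 \<le> C"
  shows "0 \<le> (LINT y:A|lebesgue. h y)"
proof (rule field_le_epsilon)
  fix e :: real assume "e > 0"
  define \<delta> where "\<delta> = e / (C + 1)"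
  have "\<delta> > 0" using \<open>e > 0\<close> \<open>0 \<le> C\<close> by (simp add: \<delta>_def)
  \<comment> \<open>With \<open>\<delta>\<close> = e/(C+1) the error C \<delta> stays below
    \<open>e\<close>; the summand 1 avoids a division by zero when \<open>C\<close> is 0.\<close>
  obtain D where D: "countable D"
      "\<And>K. K \<in> D \<Longrightarrow> K \<subseteq> cbox a b \<and> K \<noteq> {} \<and> (\<exists>c d. K = cbox c d)"
      "pairwise (\<lambda>A B. interior A \<inter> interior B = {}) D"
      "A \<subseteq> \<Union>D" "\<Union>D \<in> lmeasurable" "measure lebesgue (\<Union>D) \<le> measure lebesgue A + \<delta>"
    using measurable_outer_intervals_bounded[OF A \<open>\<delta> > 0\<close>] by metis
  \<comment> \<open>A sequence of pairwise disjoint open intervals, padded with empty sets at the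
    indices that the enumeration of \<open>D\<close> does not use; thus finite and infinite
    \<open>D\<close> are treated alike.\<close>
  define B where "B i = (if i \<in> to_nat_on D ` D then interior (from_nat_into D i) else {})" for i
  define U where "U = (\<Union>i. B i)"
  have U: "U = (\<Union>K\<in>D. interior K)"
    using D(1) unfolding U_def B_def by (auto split: if_splits)
  have B_cases: "B i = {} \<or> (\<exists>c d. c < d \<and> B i = {c<..<d})" for i
  proof (cases "i \<in> to_nat_on D ` D")
    case True
    then have "from_nat_into D i \<in> D" using D(1) by auto
    then obtain c d where "from_nat_into D i = cbox c d" using D(2) by blast
    then show ?thesis using True by (cases "c < d") (auto simp: B_def)
  qed (simp add: B_def)
  have "U \<subseteq> \<Union>D" using U interior_subset by blast
  have "U \<in> lmeasurable"
    using D(5) \<open>U \<subseteq> \<Union>D\<close> fmeasurableI2 U open_Union[of "interior ` D"]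
    by (metis (no_types, lifting) borel_open imageE lborelD open_interior sets_completionI_sets)
  then have int_U: "set_integrable lebesgue U h"
    by (rule integrable_lebesgue_AE_bounded[OF h])
  have B_sets: "B i \<in> sets lebesgue" for i using B_cases[of i] by auto
  have B_disj: "B i \<inter> B j = {}" if "i \<noteq> j" for i j
  proof (cases "i \<in> to_nat_on D ` D \<and> j \<in> to_nat_on D ` D")
    case True
    then obtain K L where "K \<in> D" "L \<in> D" "i = to_nat_on D K" "j = to_nat_on D L" by auto
    with that D(1,3) show ?thesis
      by (auto simp: B_def pairwise_def)
  qed (auto simp: B_def)
  have "0 \<le> (LINT y:B i|lebesgue. h y)" for i
    using B_cases[of i] int_nonneg by (auto simp: set_lebesgue_integral_def)
  moreover have "(\<lambda>n. LINT y:(\<Union>i<n. B i)|lebesgue. h y) \<longlonglongrightarrow> (LINT y:U|lebesgue. h y)"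
  proof -
    have "(\<Union>n. \<Union>i<n. B i) = U" by (auto simp: U_def)
    moreover have "incseq (\<lambda>n. \<Union>i<n. B i)" by (auto simp: incseq_def intro: order_less_le_trans)
    ultimately show ?thesis
      using set_integral_cont_up[of "\<lambda>n. \<Union>i<n. B i" lebesgue h] B_sets int_U by auto
  qed
  moreover have "(LINT y:(\<Union>i<n. B i)|lebesgue. h y) = (\<Sum>i<n. LINT y:B i|lebesgue. h y)" for n
    using B_sets B_disj by (intro set_integral_finite_Union set_integrable_subset[OF int_U])
      (auto simp: U_def disjoint_family_on_def)
  ultimately have U_nonneg: "0 \<le> (LINT y:U|lebesgue. h y)"
    by (intro LIMSEQ_le_const) (auto intro!: sum_nonneg)
  show "0 \<le> (LINT y:A|lebesgue. h y) + e"
  proof -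
    \<comment> \<open>Replacing the intervals by their interiors loses countably many frontiers, a
      null set.\<close>
    have "AE y in lebesgue. y \<notin> (\<Union>K\<in>D. frontier K)"
    proof -
      have "negligible (\<Union>K\<in>D. frontier K)"
        using D(1,2) by (intro negligible_countable_Union) (auto intro!: negligible_convex_frontier)
      then show ?thesis unfolding negligible_iff_null_sets by (rule AE_not_in)
    qed
    then have "AE y in lebesgue. y \<in> U \<longleftrightarrow> y \<in> \<Union>D"
    proof eventually_elim
      case (elim y)
      then show ?case
        using D(2) \<open>U \<subseteq> \<Union>D\<close> unfolding U frontier_def
        by (fastforce simp: closure_cbox)
    qed
    then have "(LINT y:\<Union>D|lebesgue. h y) = (LINT y:U|lebesgue. h y)"
      using h(1) \<open>U \<in> lmeasurable\<close> D(5)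
      by (intro set_integral_cong_set) (auto simp: set_borel_measurable_def intro!: borel_measurable_scaleR)
    moreover have "(LINT y:A \<union> (\<Union>D - A)|lebesgue. h y) = (LINT y:A|lebesgue. h y) + (LINT y:\<Union>D - A|lebesgue. h y)"
      using A D(5) by (intro set_integral_Un integrable_lebesgue_AE_bounded[OF h]) (auto intro: fmeasurable.Diff)
    moreover have "A \<union> (\<Union>D - A) = \<Union>D" using D(4) by auto
    moreover have "\<bar>LINT y:\<Union>D - A|lebesgue. h y\<bar> \<le> C * measure lebesgue (\<Union>D - A)"
      using A D(5) by (intro set_integral_bounds[OF h] fmeasurable.Diff) auto
    moreover have "C * measure lebesgue (\<Union>D - A) \<le> C * \<delta>"
      using D(4-6) A \<open>0 \<le> C\<close> by (intro mult_left_mono) (auto simp: measurable_measure_Diff)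
    moreover have "C * \<delta> \<le> e"
      using \<open>0 \<le> C\<close> \<open>e > 0\<close> by (simp add: \<delta>_def field_simps)
    ultimately show ?thesis using U_nonneg by simp
  qed
qed

text \<open>Over the part of {h < 0} inside [-n, n] the integral is non-negative by the previous
  lemma although the integrand is negative there. So it vanishes, and that part is a null set for
  each \<open>n\<close>.\<close>

lemma AE_nonneg_if_intervals:
  fixes h :: "real \<Rightarrow> real"
  assumes h: "h \<in> borel_measurable lebesgue" "AE y in lebesgue. \<bar>h y\<bar> \<le> C" "0 \<le> C"
    and int_nonneg: "\<And>a b. a < b \<Longrightarrow> 0 \<le> (LINT y:{a<..<b}|lebesgue. h y)"
  shows "AE y in lebesgue. 0 \<le> h y"
proof -
  have "AE y in lebesgue. y \<in> cbox (- real n) (real n) \<longrightarrow> 0 \<le> h y" for n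
  proof -
    define A where "A = {y. h y < 0} \<inter> cbox (- real n) (real n)"
    have "{y \<in> space lebesgue. h y < 0} \<in> sets lebesgue"
      using h(1) by measurable
    then have A: "A \<in> lmeasurable" "A \<subseteq> cbox (- real n) (real n)"
      using fmeasurable_Int_fmeasurable[of "cbox (- real n) (real n)" lebesgue "{y. h y < 0}"]
      by (auto simp: A_def Int_commute)
    have int: "integrable lebesgue (\<lambda>y. indicator A y *\<^sub>R - h y)"
      using integrable_lebesgue_AE_bounded[OF h(1,2) A(1)] unfolding set_integrable_def by simp
    have nn: "AE y in lebesgue. 0 \<le> indicator A y *\<^sub>R - h y"
      by (auto simp: A_def indicator_def)
    have "0 \<le> (LINT y:A|lebesgue. h y)"
      by (rule set_integral_nonneg_if_intervals[OF h(1,2) int_nonneg A h(3)])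
    moreover have "0 \<le> (LINT y|lebesgue. indicator A y *\<^sub>R - h y)"
      using nn by (rule integral_nonneg_AE)
    ultimately have "(LINT y|lebesgue. indicator A y *\<^sub>R - h y) = 0"
      by (simp add: set_lebesgue_integral_def)
    then have "AE y in lebesgue. indicator A y *\<^sub>R - h y = 0"
      using integral_nonneg_eq_0_iff_AE[OF int nn] by blast
    then show ?thesis
      by eventually_elim (auto simp: A_def indicator_def split: if_splits)
  qed
  then have "AE y in lebesgue. \<forall>n. y \<in> cbox (- real n) (real n) \<longrightarrow> 0 \<le> h y"
    unfolding AE_all_countable by blast
  then show ?thesis
  proof eventually_elim
    case (elim y)
    obtain n :: nat where "\<bar>y\<bar> \<le> real n" using real_arch_simple by blast
    with elim show ?case by (auto simp: abs_le_iff)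
  qed
qed

section \<open>Functions in \<open>W1inf\<close> and their optimal Lipschitz constant\<close>

lemma W1inf_weak_deriv:
  assumes "f \<in> W1inf"
  shows "continuous_on UNIV f" "\<bar>f x\<bar> \<le> Linf_norm UNIV f"
    "weak_deriv f \<in> Linf UNIV" "has_weak_derivative f (weak_deriv f)"
    "a < b \<Longrightarrow> (LINT x:{a<..<b}|lebesgue. weak_deriv f x) = f b - f a"
proof -
  show f: "continuous_on UNIV f" and bd: "\<bar>f x\<bar> \<le> Linf_norm UNIV f" for x
    using assms continuous_AE_bound[OF _ Linf_UNIV_D(2)] by (auto simp: W1inf_def)
  have "\<exists>g. g \<in> Linf UNIV \<and> has_weak_derivative f g"
    using assms by (auto simp: W1inf_def)
  from someI_ex[OF this] show g: "weak_deriv f \<in> Linf UNIV" "has_weak_derivative f (weak_deriv f)"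
    unfolding weak_deriv_def by auto
  show "(LINT x:{a<..<b}|lebesgue. weak_deriv f x) = f b - f a" if "a < b"
    by (rule weak_derivative_FTC[OF f bd g that])
qed

lemma W1inf_Lipschitz:
  assumes "f \<in> W1inf"
  shows "\<bar>f x - f y\<bar> \<le> Linf_norm UNIV (weak_deriv f) * \<bar>x - y\<bar>"
proof -
  have *: "\<bar>f b - f a\<bar> \<le> Linf_norm UNIV (weak_deriv f) * \<bar>b - a\<bar>" if "a < b" for a b
    using set_integral_bounds[OF Linf_UNIV_D[OF W1inf_weak_deriv(3)[OF assms]], of "{a<..<b}"]
      W1inf_weak_deriv(5)[OF assms that] that by simp
  consider "x < y" | "x = y" | "y < x" by linarith
  then show ?thesis
    using *[of x y] *[of y x] by cases (simp_all add: abs_minus_commute)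
qed

text \<open>The converse of \<open>W1inf_Lipschitz\<close>. With g the weak derivative, K - g and K
  + g have non-negative integrals over all intervals and are therefore non-negative almost
  everywhere; the factor \<open>s\<close> treats both signs at once.\<close>

lemma W1inf_weak_deriv_norm_le:
  assumes "f \<in> W1inf" "0 \<le> K" and K: "\<And>a b. a < b \<Longrightarrow> \<bar>f b - f a\<bar> \<le> K * (b - a)"
  shows "Linf_norm UNIV (weak_deriv f) \<le> K"
proof -
  let ?g = "weak_deriv f" and ?G = "Linf_norm UNIV (weak_deriv f)"
  note g = Linf_UNIV_D[OF W1inf_weak_deriv(3)[OF assms(1)]]
  note [measurable] = g(1)
  have *: "AE y in lebesgue. 0 \<le> K - s * ?g y" if "\<bar>s\<bar> = 1" for s
  proof (rule AE_nonneg_if_intervals[where C="K + ?G"])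
    show "AE y in lebesgue. \<bar>K - s * ?g y\<bar> \<le> K + ?G"
      using g(2)
    proof eventually_elim
      case (elim y)
      have "\<bar>K - s * ?g y\<bar> \<le> \<bar>K\<bar> + \<bar>s\<bar> * \<bar>?g y\<bar>" by (metis abs_mult abs_triangle_ineq4)
      with elim assms(2) that show ?case by simp
    qed
    fix a b :: real assume "a < b"
    have "set_integrable lebesgue {a<..<b} ?g"
      by (intro integrable_lebesgue_AE_bounded[OF g]) simp
    moreover have "set_integrable lebesgue {a<..<b} (\<lambda>y. K)"
      by (intro integrable_lebesgue_AE_bounded[where C=K]) (use assms(2) in auto)
    moreover have "(LINT y:{a<..<b}|lebesgue. K) = K * (b - a)"
      using \<open>a < b\<close> by (simp add: set_lebesgue_integral_def)
    ultimately have "(LINT y:{a<..<b}|lebesgue. K - s * ?g y) = K * (b - a) - s * (f b - f a)"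
      using W1inf_weak_deriv(5)[OF assms(1) \<open>a < b\<close>] by (subst set_integral_diff) auto
    moreover have "s * (f b - f a) \<le> \<bar>s\<bar> * \<bar>f b - f a\<bar>"
      by (metis abs_ge_self abs_mult)
    ultimately show "0 \<le> (LINT y:{a<..<b}|lebesgue. K - s * ?g y)"
      using K[OF \<open>a < b\<close>] that by simp
  qed (use assms(2) Linf_norm_nonneg in \<open>auto\<close>)
  show ?thesis
  proof (rule Linf_norm_le)
    show "?g \<in> borel_measurable (lebesgue_on UNIV)" using g(1) by (simp add: lebesgue_on_UNIV_eq)
    show "AE x in lebesgue_on UNIV. \<bar>?g x\<bar> \<le> K"
      unfolding lebesgue_on_UNIV_eq
      using *[of 1, simplified] *[of "-1", simplified] by eventually_elim simp
  qed fact
qed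

section \<open>Measurability in time\<close>

text \<open>\<open>N\<close> is characterised as a least upper bound for almost every
  \<open>s\<close>, as the family may be unbounded on the exceptional null set. The supremum is
  taken in the extended reals, and completeness of Lebesgue measure carries its measurability over
  to \<open>N\<close>. Testing against c \<ge> 0 is enough because the family is non-negative and
  \<open>I\<close> is non-empty.\<close>

lemma borel_measurable_AE_Sup:
  fixes N :: "real \<Rightarrow> real" and F :: "'i \<Rightarrow> real \<Rightarrow> real"
  assumes I: "countable I" "I \<noteq> {}" and F: "\<And>i. i \<in> I \<Longrightarrow> F i \<in> borel_measurable lebesgue"
    and N: "AE s in lebesgue. (\<forall>i\<in>I. 0 \<le> F i s \<and> F i s \<le> N s) \<and>
      (\<forall>c\<ge>0. (\<forall>i\<in>I. F i s \<le> c) \<longrightarrow> N s \<le> c)"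
  shows "N \<in> borel_measurable lebesgue"
proof (rule borel_measurable_AE)
  show "(\<lambda>s. real_of_ereal (SUP i\<in>I. ereal (F i s))) \<in> borel_measurable lebesgue"
    using I F by measurable
  show "AE s in lebesgue. real_of_ereal (SUP i\<in>I. ereal (F i s)) = N s"
    using N
  proof eventually_elim
    case (elim s)
    have "(SUP i\<in>I. ereal (F i s)) = ereal (N s)"
    proof (rule antisym)
      show "(SUP i\<in>I. ereal (F i s)) \<le> ereal (N s)"
        using elim by (intro SUP_least) auto
      show "ereal (N s) \<le> (SUP i\<in>I. ereal (F i s))"
      proof (cases "SUP i\<in>I. ereal (F i s)")
        case (real c)
        then have "F i s \<le> c" if "i \<in> I" for i
          using SUP_upper[OF that, of "\<lambda>i. ereal (F i s)"] by simp
        moreover from this I(2) elim have "0 \<le> c" by (meson all_not_in_conv order_trans)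
        ultimately show ?thesis using elim real by simp
      next
        case MInf
        obtain i where "i \<in> I" using I(2) by blast
        with MInf show ?thesis using SUP_upper[of i I "\<lambda>i. ereal (F i s)"] by simp
      qed simp
    qed
    then show ?case by simp
  qed
qed

text \<open>The rational points of an open set are dense in it, hence in its closure.\<close>

lemma continuous_le_on_closure_Rats:
  fixes f :: "real \<Rightarrow> real"
  assumes "continuous_on UNIV f" "open S" "\<And>q. q \<in> S \<inter> \<rat> \<Longrightarrow> f q \<le> c" "x \<in> closure S"
  shows "f x \<le> c"
proof -
  have "S \<subseteq> closure (S \<inter> \<rat>)"
    using open_Int_closure_subset[OF \<open>open S\<close>, of \<rat>] by (simp add: Rats_closure_real)
  then have "closure S \<subseteq> closure (S \<inter> \<rat>)"
    by (rule closure_minimal) simp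
  moreover have "closure (S \<inter> \<rat>) \<subseteq> {x. f x \<le> c}"
    using assms(1,3) by (intro closure_minimal closed_Collect_le continuous_intros) auto
  ultimately show ?thesis using assms(4) by blast
qed

text \<open>The bounds are demanded at every time, even outside (0,T), so that no exceptional null
  sets appear in the stability estimates.\<close>

definition regular_field :: "(real \<Rightarrow> real \<Rightarrow> real) \<Rightarrow> real \<Rightarrow> real \<Rightarrow> bool" where
  "regular_field \<mu> M L \<longleftrightarrow> (\<forall>y. (\<lambda>s. \<mu> s y) \<in> borel_measurable lebesgue) \<and>
     (\<forall>s y. \<bar>\<mu> s y\<bar> \<le> M) \<and> (\<forall>s y z. \<bar>\<mu> s y - \<mu> s z\<bar> \<le> L * \<bar>y - z\<bar>)"

lemma Linf_AE_le_norm_Ioo: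
  assumes "N \<in> borel_measurable lebesgue" "AE s in lebesgue. s \<in> {0<..<T} \<longrightarrow> \<bar>N s\<bar> \<le> C"
  shows "AE s in lebesgue. s \<in> {0<..<T} \<longrightarrow> \<bar>N s\<bar> \<le> Linf_norm {0<..<T} N"
proof -
  have "N \<in> Linf {0<..<T}"
    using assms unfolding Linf_def
    by (auto intro!: exI[of _ C] measurable_restrict_space1 simp: AE_restrict_space_iff)
  from Linf_AE_le_norm[OF this] show ?thesis
    by (simp add: AE_restrict_space_iff)
qed

text \<open>This allows functions of time to be replaced by their extensions by 0. Agreement on the
  interval also transfers measurability, so the default value 0 cannot intervene on one side
  only.\<close>

lemma Linf_norm_cong_Ioo:
  assumes "\<And>s. s \<in> {0<..<T} \<Longrightarrow> N s = N' s"
  shows "Linf_norm {0<..<T} N = Linf_norm {0<..<T} N'"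
proof -
  have "(\<lambda>s. ereal \<bar>N s\<bar>) \<in> borel_measurable (lebesgue_on {0<..<T}) \<longleftrightarrow>
      (\<lambda>s. ereal \<bar>N' s\<bar>) \<in> borel_measurable (lebesgue_on {0<..<T})"
    using assms by (intro measurable_cong) auto
  moreover have "(AE s in lebesgue_on {0<..<T}. ereal \<bar>N s\<bar> \<le> z) \<longleftrightarrow> (AE s in lebesgue_on {0<..<T}. ereal \<bar>N' s\<bar> \<le> z)" for z
    using assms by (intro AE_cong) auto
  ultimately show ?thesis
    unfolding Linf_norm_def
    by (cases "(\<lambda>s. ereal \<bar>N s\<bar>) \<in> borel_measurable (lebesgue_on {0<..<T})")
      (auto simp: esssup_eq_AE esssup_non_measurable)
qed

text \<open>\<open>\<mu>\<close> agrees with \<open>lam\<close> at good times and is 0 at all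
  others. A time in (0,T) is good if \<open>lam s\<close> lies in \<open>W1inf\<close> and its two
  norms obey their essential bounds in time. Almost every time is good once these norms are known to
  be measurable in \<open>s\<close>.\<close>

lemma Linf_W1inf_regular_version:
  assumes lam: "lam \<in> Linf_W1inf T"
  obtains \<mu> where
    "regular_field \<mu> (Linf_Linf_norm T lam) (Linf_Linf_norm T (partial2 lam))"
    "AE s in lebesgue. s \<in> {0<..<T} \<longrightarrow> \<mu> s = lam s"
proof -
  define J where "J = {0<..<T}"
  have J: "J \<in> sets lebesgue" by (simp add: J_def)
  obtain C where
    meas: "\<And>y. (\<lambda>s. lam s y) \<in> borel_measurable (lebesgue_on J)" and
    W: "AE s in lebesgue. s \<in> J \<longrightarrow> lam s \<in> W1inf" and
    C: "AE s in lebesgue. s \<in> J \<longrightarrow> W1inf_norm (lam s) \<le> C"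
    using lam J unfolding Linf_W1inf_def J_def[symmetric] by (auto simp: AE_restrict_space_iff)
  have meas_J: "(\<lambda>s. if s \<in> J then lam s y else 0) \<in> borel_measurable lebesgue" for y
    using meas J by (simp add: borel_measurable_if)

  define N0 where "N0 s = (if s \<in> J then Linf_norm UNIV (lam s) else 0)" for s
  define N1 where "N1 s = (if s \<in> J then Linf_norm UNIV (partial2 lam s) else 0)" for s
  have "N0 \<in> borel_measurable lebesgue"
  proof (rule borel_measurable_AE_Sup[where I="\<rat>" and F="\<lambda>q s. if s \<in> J then \<bar>lam s q\<bar> else 0"])
    show "(\<lambda>s. if s \<in> J then \<bar>lam s q\<bar> else 0) \<in> borel_measurable lebesgue" for q
      using borel_measurable_abs[OF meas_J[of q]] by (simp add: if_distrib cong: if_cong)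
    show "AE s in lebesgue. (\<forall>q\<in>\<rat>. 0 \<le> (if s \<in> J then \<bar>lam s q\<bar> else 0) \<and> (if s \<in> J then \<bar>lam s q\<bar> else 0) \<le> N0 s) \<and>
        (\<forall>c\<ge>0. (\<forall>q\<in>\<rat>. (if s \<in> J then \<bar>lam s q\<bar> else 0) \<le> c) \<longrightarrow> N0 s \<le> c)"
      using W
    proof eventually_elim
      case (elim s)
      show ?case
      proof (cases "s \<in> J")
        case True
        with elim have f: "lam s \<in> W1inf" by simp
        have "Linf_norm UNIV (lam s) \<le> c" if "0 \<le> c" "\<And>q. q \<in> \<rat> \<Longrightarrow> \<bar>lam s q\<bar> \<le> c" for c
        proof (rule Linf_norm_le)
          show "lam s \<in> borel_measurable (lebesgue_on UNIV)"
            using f by (auto simp: W1inf_def Linf_def)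
          have "\<bar>lam s x\<bar> \<le> c" for x
            by (rule continuous_le_on_closure_Rats[where S=UNIV and f="\<lambda>x. \<bar>lam s x\<bar>"])
              (use W1inf_weak_deriv(1)[OF f] that in \<open>auto intro: continuous_intros\<close>)
          then show "AE x in lebesgue_on UNIV. \<bar>lam s x\<bar> \<le> c" by simp
        qed fact
        then show ?thesis using True W1inf_weak_deriv(2)[OF f] by (simp add: N0_def)
      qed (auto simp: N0_def)
    qed
  qed (use Rats_0 in \<open>auto simp: countable_rat\<close>)
  \<comment> \<open>The norm of the weak derivative is the best Lipschitz constant, so it is a
    supremum of difference quotients; by continuity, rational pairs suffice.\<close>
  define I where "I = {(p, q). p \<in> \<rat> \<and> q \<in> \<rat> \<and> p < (q::real)}"
  define F where "F i s = (if s \<in> J then \<bar>lam s (snd i) - lam s (fst i)\<bar> / (snd i - fst i) else 0)" for i s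
  have "N1 \<in> borel_measurable lebesgue"
  proof (rule borel_measurable_AE_Sup[where I=I and F=F])
    have "I \<subseteq> \<rat> \<times> \<rat>" by (auto simp: I_def)
    then show "countable I" by (rule countable_subset) (simp add: countable_rat)
    have "(0, 1) \<in> I" by (simp add: I_def)
    then show "I \<noteq> {}" by blast
    show "F i \<in> borel_measurable lebesgue" for i
    proof -
      have "F i = (\<lambda>s. \<bar>(if s \<in> J then lam s (snd i) else 0) - (if s \<in> J then lam s (fst i) else 0)\<bar> / (snd i - fst i))"
        by (auto simp: F_def)
      moreover note meas_J[measurable]
      ultimately show ?thesis by simp
    qed
    show "AE s in lebesgue. (\<forall>i\<in>I. 0 \<le> F i s \<and> F i s \<le> N1 s) \<and>
        (\<forall>c\<ge>0. (\<forall>i\<in>I. F i s \<le> c) \<longrightarrow> N1 s \<le> c)"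
      using W
    proof eventually_elim
      case (elim s)
      show ?case
      proof (cases "s \<in> J")
        case True
        with elim have f: "lam s \<in> W1inf" by simp
        have "N1 s \<le> c" if "0 \<le> c" "\<And>i. i \<in> I \<Longrightarrow> F i s \<le> c" for c
        proof -
          have *: "\<bar>lam s q - lam s p\<bar> \<le> c * (q - p)" if "p \<in> \<rat>" "q \<in> \<rat>" "p < q" for p q
            using \<open>\<And>i. i \<in> I \<Longrightarrow> F i s \<le> c\<close>[of "(p, q)"] that True
            by (simp add: I_def F_def field_simps)
          \<comment> \<open>In this symmetric form the estimate is a closed condition on a
            continuous function. Density of the rationals then frees first \<open>q\<close> and
            afterwards \<open>p\<close>.\<close>
          have rat: "\<bar>lam s q - lam s p\<bar> - c * \<bar>q - p\<bar> \<le> 0" if "p \<in> \<rat>" "q \<in> \<rat>" for p q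
          proof -
            consider "p < q" | "p = q" | "q < p" by linarith
            then show ?thesis
              using *[of p q] *[of q p] that by cases (simp_all add: abs_minus_commute)
          qed
          have half: "\<bar>lam s q - lam s p\<bar> - c * \<bar>q - p\<bar> \<le> 0" if "p \<in> \<rat>" for p q
          proof (rule continuous_le_on_closure_Rats[where S=UNIV and f="\<lambda>q. \<bar>lam s q - lam s p\<bar> - c * \<bar>q - p\<bar>"])
            show "continuous_on UNIV (\<lambda>q. \<bar>lam s q - lam s p\<bar> - c * \<bar>q - p\<bar>)"
              by (intro continuous_intros W1inf_weak_deriv(1)[OF f])
          qed (use rat that in simp_all)
          have full: "\<bar>lam s b - lam s a\<bar> - c * \<bar>b - a\<bar> \<le> 0" for a b
          proof (rule continuous_le_on_closure_Rats[where S=UNIV and f="\<lambda>a. \<bar>lam s b - lam s a\<bar> - c * \<bar>b - a\<bar>"])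
            show "continuous_on UNIV (\<lambda>a. \<bar>lam s b - lam s a\<bar> - c * \<bar>b - a\<bar>)"
              by (intro continuous_intros W1inf_weak_deriv(1)[OF f])
          qed (use half in simp_all)
          have "\<bar>lam s b - lam s a\<bar> \<le> c * (b - a)" if "a < b" for a b
            using full[of b a] that by simp
          then show ?thesis
            unfolding N1_def partial2_def using W1inf_weak_deriv_norm_le[OF f \<open>0 \<le> c\<close>] \<open>0 \<le> c\<close> by simp
        qed
        moreover have "0 \<le> F i s \<and> F i s \<le> N1 s" if "i \<in> I" for i
          using W1inf_Lipschitz[OF f, of "snd i" "fst i"] that True
          by (auto simp: I_def F_def N1_def partial2_def field_simps)
        ultimately show ?thesis by simp
      qed (simp add: N1_def F_def)
    qed
  qed
  have N_nn: "0 \<le> N0 s" "0 \<le> N1 s" for s by (auto simp: N0_def N1_def Linf_norm_nonneg)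
  \<comment> \<open>\<open>W1inf_norm\<close> controls the sum of two non-negative norms, so each of
    them is essentially bounded by \<open>C\<close>.\<close>
  have bd: "AE s in lebesgue. s \<in> J \<longrightarrow> N0 s + N1 s \<le> C"
    using C by eventually_elim (simp add: W1inf_norm_def N0_def N1_def partial2_def)
  have N_le: "AE s in lebesgue. s \<in> J \<longrightarrow> N0 s \<le> Linf_Linf_norm T lam"
      "AE s in lebesgue. s \<in> J \<longrightarrow> N1 s \<le> Linf_Linf_norm T (partial2 lam)"
  proof -
    have "AE s in lebesgue. s \<in> J \<longrightarrow> \<bar>N0 s\<bar> \<le> C"
      using bd by eventually_elim (use N_nn in \<open>auto intro: order_trans[rotated]\<close>)
    from Linf_AE_le_norm_Ioo[OF \<open>N0 \<in> _\<close> this[unfolded J_def]]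
    have "AE s in lebesgue. s \<in> J \<longrightarrow> N0 s \<le> Linf_norm {0<..<T} N0"
      unfolding J_def by eventually_elim (use N_nn in simp)
    also have "Linf_norm {0<..<T} N0 = Linf_Linf_norm T lam"
      unfolding Linf_Linf_norm_def by (rule Linf_norm_cong_Ioo) (simp add: N0_def J_def)
    finally show "AE s in lebesgue. s \<in> J \<longrightarrow> N0 s \<le> Linf_Linf_norm T lam" .
    have "AE s in lebesgue. s \<in> J \<longrightarrow> \<bar>N1 s\<bar> \<le> C"
      using bd by eventually_elim (use N_nn in \<open>auto intro: order_trans[rotated]\<close>)
    from Linf_AE_le_norm_Ioo[OF \<open>N1 \<in> _\<close> this[unfolded J_def]]
    have "AE s in lebesgue. s \<in> J \<longrightarrow> N1 s \<le> Linf_norm {0<..<T} N1"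
      unfolding J_def by eventually_elim (use N_nn in simp)
    also have "Linf_norm {0<..<T} N1 = Linf_Linf_norm T (partial2 lam)"
      unfolding Linf_Linf_norm_def by (rule Linf_norm_cong_Ioo) (simp add: N1_def J_def)
    finally show "AE s in lebesgue. s \<in> J \<longrightarrow> N1 s \<le> Linf_Linf_norm T (partial2 lam)" .
  qed
  define good where "good s \<longleftrightarrow> s \<in> J \<and> lam s \<in> W1inf \<and> N0 s \<le> Linf_Linf_norm T lam \<and>
      N1 s \<le> Linf_Linf_norm T (partial2 lam)" for s
  define \<mu> where "\<mu> s y = (if good s then lam s y else 0)" for s y
  have ae: "AE s in lebesgue. s \<in> J \<longrightarrow> good s"
    using W N_le by eventually_elim (auto simp: good_def)
  show thesis
  proof (rule that[of \<mu>])
    show "AE s in lebesgue. s \<in> {0<..<T} \<longrightarrow> \<mu> s = lam s"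
      using ae unfolding J_def[symmetric] by eventually_elim (auto simp: \<mu>_def)
    have "0 \<le> Linf_Linf_norm T lam" "0 \<le> Linf_Linf_norm T (partial2 lam)"
      by (auto simp: Linf_Linf_norm_def Linf_norm_nonneg)
    moreover have "(\<lambda>s. \<mu> s y) \<in> borel_measurable lebesgue" for y
      using meas_J[of y]
      by (rule borel_measurable_AE) (use ae in eventually_elim, auto simp: \<mu>_def good_def)
    moreover have "\<bar>lam s y\<bar> \<le> Linf_Linf_norm T lam"
      "\<bar>lam s y - lam s z\<bar> \<le> Linf_Linf_norm T (partial2 lam) * \<bar>y - z\<bar>" if "good s" for s y z
    proof -
      have f: "lam s \<in> W1inf" and le: "Linf_norm UNIV (lam s) \<le> Linf_Linf_norm T lam"
        "Linf_norm UNIV (weak_deriv (lam s)) \<le> Linf_Linf_norm T (partial2 lam)"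
        using that by (auto simp: good_def N0_def N1_def partial2_def)
      show "\<bar>lam s y\<bar> \<le> Linf_Linf_norm T lam"
        using W1inf_weak_deriv(2)[OF f] le(1) by (rule order_trans)
      show "\<bar>lam s y - lam s z\<bar> \<le> Linf_Linf_norm T (partial2 lam) * \<bar>y - z\<bar>"
        using W1inf_Lipschitz[OF f] mult_right_mono[OF le(2) abs_ge_zero] by (rule order_trans)
    qed
    ultimately show "regular_field \<mu> (Linf_Linf_norm T lam) (Linf_Linf_norm T (partial2 lam))"
      by (auto simp: regular_field_def \<mu>_def)
  qed
qed

section \<open>Stability of solutions\<close>

text \<open>Writing oriented integrals as differences of one function removes later case
  distinctions on the order of the end points; \<open>lo\<close> and \<open>hi\<close> become bounds
  on the slopes of \<open>H\<close>.\<close>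

lemma bounded_antiderivative:
  fixes h :: "real \<Rightarrow> real"
  assumes h: "h \<in> borel_measurable lebesgue" "\<And>y. lo \<le> h y" "\<And>y. h y \<le> hi"
  obtains H where "\<And>a b. (LINT y=ereal a..ereal b|lebesgue. h y) = H b - H a"
    "\<And>a b. a \<le> b \<Longrightarrow> lo * (b - a) \<le> H b - H a"
    "\<And>a b. a \<le> b \<Longrightarrow> H b - H a \<le> hi * (b - a)"
proof -
  define J where "J a b = (LINT y:{a<..<b}|lebesgue. h y)" for a b
  have int: "set_integrable lebesgue S h" if "S \<in> lmeasurable" for S
  proof (rule integrable_lebesgue_AE_bounded[OF h(1) _ that])
    show "AE y in lebesgue. \<bar>h y\<bar> \<le> \<bar>lo\<bar> + \<bar>hi\<bar>"
      using h(2,3) by (intro AE_I2) (smt (verit))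
  qed
  have const: "(LINT y:{a<..<b}|lebesgue. c) = c * (b - a)" "set_integrable lebesgue {a<..<b} (\<lambda>y. c)"
    if "a \<le> b" for a b c :: real
    using that by (auto simp: set_lebesgue_integral_def set_integrable_def)
  have J_bounds: "lo * (b - a) \<le> J a b" "J a b \<le> hi * (b - a)" if "a \<le> b" for a b
    unfolding J_def const(1)[OF that, symmetric]
    using h(2,3) by (intro set_integral_mono int const(2)[OF that]; simp)+
  have J_add: "J a c = J a b + J b c" if "a \<le> b" "b \<le> c" for a b c
  proof -
    have "J a c = (LINT y:{a<..<b} \<union> {b<..<c}|lebesgue. h y)"
      unfolding J_def using that by (intro set_integral_discrete_difference[where X="{b}"]) auto
    also have "\<dots> = J a b + J b c"
      unfolding J_def by (intro set_integral_Un int) auto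
    finally show ?thesis .
  qed
  define H where "H x = (if 0 \<le> x then J 0 x else - J x 0)" for x
  have H: "J a b = H b - H a" if "a \<le> b" for a b
  proof -
    consider "0 \<le> a" | "a < 0" "0 \<le> b" | "b < 0" by linarith
    then show ?thesis
    proof cases
      case 1
      then have "H a = J 0 a" "H b = J 0 b" using that by (simp_all add: H_def)
      then show ?thesis using J_add[of 0 a b] 1 that by linarith
    next
      case 2
      then have "H a = - J a 0" "H b = J 0 b" by (simp_all add: H_def)
      then show ?thesis using J_add[of a 0 b] 2 by linarith
    next
      case 3
      then have "H a = - J a 0" "H b = - J b 0" using that by (simp_all add: H_def)
      then show ?thesis using J_add[of a b 0] 3 that by linarith
    qed
  qed
  show thesis
  proof (rule that[of H])
    show "(LINT y=ereal a..ereal b|lebesgue. h y) = H b - H a" for a b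
      using H[of a b] H[of b a]
      by (cases "a \<le> b") (simp_all add: interval_lebesgue_integral_def J_def[symmetric])
    show "lo * (b - a) \<le> H b - H a" "H b - H a \<le> hi * (b - a)" if "a \<le> b" for a b
      using J_bounds[OF that] unfolding H[OF that] .
  qed
qed

text \<open>\<open>x\<close> is approximated by functions with values in the multiples of 1/(n+1).
  With countably many values the composition is measurable piece by piece, and the Lipschitz bound
  in the second argument yields the pointwise limit.\<close>

lemma regular_field_Caratheodory:
  assumes \<mu>: "regular_field \<mu> M L" and x: "continuous_on UNIV x"
  shows "(\<lambda>s. \<mu> s (x s)) \<in> borel_measurable lebesgue"
proof (rule borel_measurable_LIMSEQ_real)
  define r where "r n s = real_of_int \<lfloor>real (Suc n) * x s\<rfloor> / real (Suc n)" for n s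
  have "x \<in> borel_measurable borel"
    using x by (rule borel_measurable_continuous_onI)
  then have [measurable]: "x \<in> borel_measurable lebesgue"
    by (intro measurable_completion) (simp only: measurable_lborel2)
  show "(\<lambda>s. \<mu> s (r n s)) \<in> borel_measurable lebesgue" for n
    unfolding r_def
  proof (rule measurable_compose_countable[where g="\<lambda>s. \<lfloor>real (Suc n) * x s\<rfloor>"])
    show "(\<lambda>s. \<mu> s (real_of_int i / real (Suc n))) \<in> borel_measurable lebesgue" for i
      using \<mu> by (simp add: regular_field_def)
    show "(\<lambda>s. \<lfloor>real (Suc n) * x s\<rfloor>) \<in> lebesgue \<rightarrow>\<^sub>M count_space UNIV"
      by measurable
  qed
  show "(\<lambda>n. \<mu> s (r n s)) \<longlonglongrightarrow> \<mu> s (x s)" for s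
  proof (rule Lim_null_comparison[where g="\<lambda>n. \<bar>L\<bar> * (1 / real (Suc n))", THEN LIM_zero_cancel])
    have "\<bar>r n s - x s\<bar> \<le> 1 / real (Suc n)" for n
    proof -
      have "\<bar>real_of_int \<lfloor>real (Suc n) * x s\<rfloor> - real (Suc n) * x s\<bar> \<le> 1" by linarith
      moreover have "r n s - x s = (real_of_int \<lfloor>real (Suc n) * x s\<rfloor> - real (Suc n) * x s) / real (Suc n)"
        by (simp add: r_def diff_divide_distrib)
      ultimately show ?thesis by (simp add: divide_right_mono)
    qed
    then have "\<bar>L\<bar> * \<bar>r n s - x s\<bar> \<le> \<bar>L\<bar> * (1 / real (Suc n))" for n
      by (intro mult_left_mono) auto
    moreover have "\<bar>\<mu> s (r n s) - \<mu> s (x s)\<bar> \<le> \<bar>L\<bar> * \<bar>r n s - x s\<bar>" for n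
    proof -
      have "\<bar>\<mu> s (r n s) - \<mu> s (x s)\<bar> \<le> L * \<bar>r n s - x s\<bar>"
        using \<mu> by (simp add: regular_field_def)
      also have "\<dots> \<le> \<bar>L\<bar> * \<bar>r n s - x s\<bar>" by (intro mult_right_mono) auto
      finally show ?thesis .
    qed
    ultimately show "\<forall>\<^sub>F n in sequentially. norm (\<mu> s (r n s) - \<mu> s (x s)) \<le> \<bar>L\<bar> * (1 / real (Suc n))"
      by (intro always_eventually allI) (auto intro: order_trans)
    have "(\<lambda>n. \<bar>L\<bar> * (1 / real (Suc n))) \<longlonglongrightarrow> \<bar>L\<bar> * 0"
      by (intro tendsto_mult tendsto_const LIMSEQ_Suc[OF lim_const_over_n])
    then show "(\<lambda>n. \<bar>L\<bar> * (1 / real (Suc n))) \<longlonglongrightarrow> 0" by simp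
  qed
qed

lemma regular_field_continuous:
  assumes "regular_field \<mu> M L" shows "continuous_on UNIV (\<mu> s)"
proof -
  have "(\<bar>L\<bar>)-lipschitz_on UNIV (\<mu> s)"
  proof (rule lipschitz_onI)
    fix y z
    have "\<bar>\<mu> s y - \<mu> s z\<bar> \<le> L * \<bar>y - z\<bar>" using assms by (simp add: regular_field_def)
    also have "\<dots> \<le> \<bar>L\<bar> * \<bar>y - z\<bar>" by (intro mult_right_mono) auto
    finally show "dist (\<mu> s y) (\<mu> s z) \<le> \<bar>L\<bar> * dist y z" by (simp add: dist_real_def)
  qed simp
  then show ?thesis by (rule lipschitz_on_continuous_on)
qed

text \<open>\<open>B\<close> is the integrand of the first summand of the estimate. The two shapes
  of \<open>X\<close> are those of \<open>Xset_cases\<close>: a single value, or a supremum over the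
  rational points of an open set. The bound is extended to the closure because the solution is
  confined only to a closed interval.\<close>

lemma sup_norm_on_regular:
  assumes \<mu>: "regular_field \<mu> M L" and \<mu>': "regular_field \<mu>' M' L'"
    and X: "X = {c} \<or> (open X \<and> X \<noteq> {})"
  defines "B \<equiv> \<lambda>s. sup_norm_on X (\<lambda>y. \<mu> s y - \<mu>' s y)"
  shows "B \<in> borel_measurable lebesgue" "0 \<le> B s" "B s \<le> M + M'"
    "y \<in> closure X \<Longrightarrow> \<bar>\<mu> s y - \<mu>' s y\<bar> \<le> B s"
proof -
  define f where "f s y = \<bar>\<mu> s y - \<mu>' s y\<bar>" for s y
  have bd: "f s y \<le> M + M'" for s y
    using \<mu> \<mu>' unfolding regular_field_def f_def by (meson abs_triangle_ineq4 add_mono order_trans)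
  have cont: "continuous_on UNIV (f s)" for s
    unfolding f_def by (intro continuous_intros regular_field_continuous[OF \<mu>] regular_field_continuous[OF \<mu>'])
  have B: "B s = (SUP y\<in>X. f s y)" for s by (simp add: B_def sup_norm_on_def f_def)
  have "X \<noteq> {}" using X by auto
  have upper: "f s y \<le> B s" if "y \<in> X" for s y
    unfolding B using that bd by (intro cSUP_upper bdd_aboveI2[where M="M + M'"])
  obtain y0 where "y0 \<in> X" using \<open>X \<noteq> {}\<close> by blast
  have "0 \<le> f s y" for s y by (simp add: f_def)
  then show "0 \<le> B s" using upper[OF \<open>y0 \<in> X\<close>] by (rule order_trans)
  show "B s \<le> M + M'"
    unfolding B using \<open>X \<noteq> {}\<close> bd by (intro cSUP_least)
  have "X \<subseteq> {y. f s y \<le> B s}" using upper by auto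
  then have "closure X \<subseteq> {y. f s y \<le> B s}"
    using cont by (intro closure_minimal closed_Collect_le continuous_intros) auto
  then show "\<bar>\<mu> s y - \<mu>' s y\<bar> \<le> B s" if "y \<in> closure X"
    using that by (auto simp: f_def)
  have meas: "(\<lambda>s. f s y) \<in> borel_measurable lebesgue" for y
    using \<mu> \<mu>' unfolding f_def regular_field_def by (intro borel_measurable_abs borel_measurable_diff) auto
  show "B \<in> borel_measurable lebesgue"
    using X
  proof
    assume "X = {c}"
    then have "B = (\<lambda>s. f s c)" by (auto simp: B)
    then show ?thesis using meas by simp
  next
    assume X: "open X \<and> X \<noteq> {}"
    show ?thesis
    proof (rule borel_measurable_AE_Sup[where I="X \<inter> \<rat>" and F="\<lambda>y s. f s y"])
      show "countable (X \<inter> \<rat>)" by (intro countable_Int2 countable_rat)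
      show "X \<inter> \<rat> \<noteq> {}"
        using open_Int_closure_eq_empty[of X \<rat>] X by (simp add: Rats_closure_real)
      show "AE s in lebesgue. (\<forall>y\<in>X \<inter> \<rat>. 0 \<le> f s y \<and> f s y \<le> B s) \<and>
          (\<forall>c\<ge>0. (\<forall>y\<in>X \<inter> \<rat>. f s y \<le> c) \<longrightarrow> B s \<le> c)"
      proof (intro AE_I2 conjI allI impI ballI)
        fix s c assume c: "\<forall>y\<in>X \<inter> \<rat>. f s y \<le> c"
        have "f s y \<le> c" if "y \<in> X" for y
          by (rule continuous_le_on_closure_Rats[OF cont, of X])
            (use X c that closure_subset in auto)
        then show "B s \<le> c" unfolding B using \<open>X \<noteq> {}\<close> by (intro cSUP_least)
      qed (use upper in \<open>auto simp: f_def\<close>)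
    qed (rule meas)
  qed
qed

text \<open>The right-hand side \<open>w\<close> satisfies w' = c u \<le> c w, so w(s) exp(-c s) is
  non-increasing, starting from \<open>K\<close>.\<close>

lemma Gronwall:
  fixes u :: "real \<Rightarrow> real"
  assumes "0 \<le> t" "0 \<le> c" and u: "continuous_on {0..t} u"
    and le: "\<And>s. s \<in> {0..t} \<Longrightarrow> u s \<le> K + c * integral {0..s} u"
  shows "u t \<le> K * exp (c * t)"
proof -
  define w where "w s = K + c * integral {0..s} u" for s
  have w: "(w has_real_derivative c * u s) (at s within {0..t})" if "s \<in> {0..t}" for s
    unfolding w_def
    using integral_has_real_derivative[OF u that] by (auto intro!: derivative_eq_intros)
  define \<phi> where "\<phi> s = w s * exp (- (c * s))" for s
  have \<phi>: "(\<phi> has_real_derivative c * (u s - w s) * exp (- (c * s))) (at s within {0..t})"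
    if "s \<in> {0..t}" for s
    unfolding \<phi>_def using w[OF that] by (auto intro!: derivative_eq_intros simp: algebra_simps)
  have "\<phi> t \<le> \<phi> 0"
  proof (rule DERIV_nonpos_imp_decreasing_open[OF \<open>0 \<le> t\<close>])
    fix s assume "0 < s" "s < t"
    then have "(\<phi> has_real_derivative c * (u s - w s) * exp (- (c * s))) (at s)"
      using \<phi>[of s] by (simp add: at_within_Icc_at)
    moreover have "c * (u s - w s) * exp (- (c * s)) \<le> 0"
      using le[of s] \<open>0 < s\<close> \<open>s < t\<close> \<open>0 \<le> c\<close>
      by (intro mult_nonpos_nonneg mult_nonneg_nonpos) (auto simp: w_def)
    ultimately show "\<exists>y. DERIV \<phi> s :> y \<and> y \<le> 0" by blast
  next
    show "continuous_on {0..t} \<phi>" using \<phi> by (intro DERIV_continuous_on)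
  qed
  then have "w t \<le> K * exp (c * t)"
    by (simp add: \<phi>_def w_def exp_minus field_simps)
  moreover have "u t \<le> w t" using le[of t] \<open>0 \<le> t\<close> by (simp add: w_def)
  ultimately show ?thesis by simp
qed

lemma interval_lebesgue_integral_real:
  fixes a b :: real
  assumes "a \<le> b"
  shows "(LINT s=ereal a..ereal b|M. f s) = (LINT s:{a<..<b}|M. f s)"
  using assms by (simp add: interval_lebesgue_integral_le_eq)

text \<open>\<open>H\<close> measures travel time at speed \<open>v\<close>. Its slopes lie between
  1/V and 1/c, so times and distances control each other.\<close>

lemma speed_inverse_bounds:
  fixes v :: "real \<Rightarrow> real"
  assumes "v \<in> borel_measurable lebesgue" "\<And>y. c \<le> v y" "\<And>y. v y \<le> V" "0 < c"
  obtains H where "\<And>a b. (LINT y=ereal a..ereal b|lebesgue. (1 / v y)) = H b - H a"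
    "\<And>a b. \<bar>b - a\<bar> \<le> V * \<bar>H b - H a\<bar>" "\<And>a b. \<bar>H b - H a\<bar> \<le> \<bar>b - a\<bar> / c"
    "\<And>a b. a \<le> b \<Longrightarrow> b - a \<le> V * (H b - H a)"
proof -
  have v_pos: "0 < v y" for y using assms(2)[of y] \<open>0 < c\<close> by linarith
  have "0 < V" using v_pos[of 0] assms(3)[of 0] by linarith
  note [measurable] = assms(1)
  have "(\<lambda>y. 1 / v y) \<in> borel_measurable lebesgue" by measurable
  moreover have "1 / V \<le> 1 / v y" "1 / v y \<le> 1 / c" for y
    using assms(2,3)[of y] v_pos[of y] \<open>0 < c\<close> by (auto intro!: divide_left_mono)
  ultimately obtain H where H: "\<And>a b. (LINT y=ereal a..ereal b|lebesgue. (1 / v y)) = H b - H a"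
    "\<And>a b. a \<le> b \<Longrightarrow> 1 / V * (b - a) \<le> H b - H a"
    "\<And>a b. a \<le> b \<Longrightarrow> H b - H a \<le> 1 / c * (b - a)"
    by (rule bounded_antiderivative[where h="\<lambda>y. 1 / v y" and lo="1 / V" and hi="1 / c"]) blast
  have up: "b - a \<le> V * (H b - H a)" if "a \<le> b" for a b
    using H(2)[OF that] \<open>0 < V\<close> by (simp add: field_simps)
  have dn: "H b - H a \<le> (b - a) / c" if "a \<le> b" for a b
    using H(3)[OF that] by simp
  have mono: "H a \<le> H b" if "a \<le> b" for a b
    using H(2)[OF that] that \<open>0 < V\<close> by (smt (verit, best) divide_nonneg_pos mult_nonneg_nonneg)
  show thesis
  proof (rule that[OF H(1) _ _ up])
    fix a b
    show "\<bar>b - a\<bar> \<le> V * \<bar>H b - H a\<bar>"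
      using up[of a b] up[of b a] mono[of a b] mono[of b a] by (cases "a \<le> b") simp_all
    show "\<bar>H b - H a\<bar> \<le> \<bar>b - a\<bar> / c"
      using dn[of a b] dn[of b a] mono[of a b] mono[of b a] by (cases "a \<le> b") simp_all
  qed
qed

text \<open>The estimate for data that are regular everywhere. \<open>B\<close> has to dominate the
  difference of the fields at all points which \<open>x\<close> can reach, and these lie within T V
  M of \<open>x0\<close>. \<open>Y\<close> has to contain the open interval between
  \<open>x0\<close> and the auxiliary point \<open>z\<close>; its radius T V M' involves the second
  field, because the travel time from \<open>x0\<close> to \<open>z\<close> is that of the second
  solution.\<close>

lemma regular_solutions_stability:
  fixes v v' x x' B :: "real \<Rightarrow> real"
  assumes "0 < c" and t: "0 \<le> t" "t \<le> T"
    and v: "v \<in> borel_measurable lebesgue" "\<And>y. c \<le> v y" "\<And>y. v y \<le> V"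
    and v': "v' \<in> borel_measurable lebesgue" "\<And>y. c \<le> v' y" "\<And>y. v' y \<le> V'"
    and \<mu>: "regular_field \<mu> M L" and \<mu>': "regular_field \<mu>' M' L'"
    and x: "continuous_on UNIV x" and x': "continuous_on UNIV x'"
    and sol: "\<And>s. s \<in> {0..T} \<Longrightarrow>
      (LINT y=x0..x s|lebesgue. (1 / v y)) = (LINT r=0..s|lebesgue. \<mu> r (x r))"
    and sol': "\<And>s. s \<in> {0..T} \<Longrightarrow>
      (LINT y=x0'..x' s|lebesgue. (1 / v' y)) = (LINT r=0..s|lebesgue. \<mu>' r (x' r))"
    and B: "B \<in> borel_measurable lebesgue" "\<And>s. 0 \<le> B s" "\<And>s. B s \<le> C"
      "\<And>s y. \<bar>y - x0\<bar> \<le> T * V * M \<Longrightarrow> \<bar>\<mu> s y - \<mu>' s y\<bar> \<le> B s"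
    and "L' \<le> L2" "0 \<le> L2"
    and Y: "Y = {yl<..<yu}" "yl \<le> x0 - T * V * M'" "x0 + T * V * M' \<le> yu"
  shows "\<bar>x t - x' t\<bar> \<le> V * exp (t * V * L2) * (LINT s=0..t|lebesgue. B s) +
    (V * exp (t * V * L2) * t * L2 + 1) * (V' / c) * (\<bar>x0 - x0'\<bar> + 1 / c * (LINT y:Y|lebesgue. \<bar>v y - v' y\<bar>))"
proof -
  have "0 < V" "0 < V'" using v(2,3)[of 0] v'(2,3)[of 0] \<open>0 < c\<close> by linarith+
  have "0 \<le> M" "0 \<le> M'"
    using \<mu> \<mu>' abs_ge_zero order_trans unfolding regular_field_def by blast+
  have "0 \<le> T" using t by linarith
  obtain H where H: "\<And>a b. (LINT y=ereal a..ereal b|lebesgue. (1 / v y)) = H b - H a"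
    "\<And>a b. \<bar>b - a\<bar> \<le> V * \<bar>H b - H a\<bar>" "\<And>a b. \<bar>H b - H a\<bar> \<le> \<bar>b - a\<bar> / c"
    "\<And>a b. a \<le> b \<Longrightarrow> b - a \<le> V * (H b - H a)"
    by (rule speed_inverse_bounds[OF v \<open>0 < c\<close>]) blast
  obtain H' where H': "\<And>a b. (LINT y=ereal a..ereal b|lebesgue. (1 / v' y)) = H' b - H' a"
    "\<And>a b. \<bar>b - a\<bar> \<le> V' * \<bar>H' b - H' a\<bar>" "\<And>a b. \<bar>H' b - H' a\<bar> \<le> \<bar>b - a\<bar> / c"
    by (rule speed_inverse_bounds[OF v' \<open>0 < c\<close>]) blast
  define A where "A s = (LINT r:{0<..<s}|lebesgue. \<mu> r (x r))" for s
  define A' where "A' s = (LINT r:{0<..<s}|lebesgue. \<mu>' r (x' r))" for s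
  have A: "H (x s) - H x0 = A s" "H' (x' s) - H' x0' = A' s" if "s \<in> {0..T}" for s
    using sol[OF that] sol'[OF that] that H(1)[of x0 "x s"] H'(1)[of x0' "x' s"]
      interval_lebesgue_integral_real[of 0 s lebesgue]
    unfolding A_def A'_def zero_ereal_def by simp_all
  note meas = regular_field_Caratheodory[OF \<mu> x] regular_field_Caratheodory[OF \<mu>' x']
  have A_bound: "\<bar>A s\<bar> \<le> T * M" "\<bar>A' s\<bar> \<le> T * M'" if "s \<in> {0..T}" for s
  proof -
    have "\<bar>A s\<bar> \<le> M * measure lebesgue {0<..<s}" "\<bar>A' s\<bar> \<le> M' * measure lebesgue {0<..<s}"
      unfolding A_def A'_def using \<mu> \<mu>' by (intro set_integral_bounds meas; simp add: regular_field_def)+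
    moreover have "M * s \<le> M * T" "M' * s \<le> M' * T"
      using that \<open>0 \<le> M\<close> \<open>0 \<le> M'\<close> by (simp_all add: mult_left_mono)
    ultimately show "\<bar>A s\<bar> \<le> T * M" "\<bar>A' s\<bar> \<le> T * M'" using that by (simp_all add: mult.commute)
  qed
  define W where "W = (LINT y:Y|lebesgue. \<bar>v y - v' y\<bar>)"
  \<comment> \<open>\<open>D\<close> will bound the distance between \<open>z\<close> and
    \<open>x' s\<close>, uniformly in \<open>s\<close>.\<close>
  define D where "D = V' / c * (\<bar>x0 - x0'\<bar> + 1 / c * W)"
  define b where "b = (LINT s:{0<..<t}|lebesgue. B s)"
  define u where "u s = \<bar>x s - x' s\<bar>" for s
  have "0 \<le> W" by (simp add: W_def set_lebesgue_integral_def)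
  then have "0 \<le> D" using \<open>0 < V'\<close> \<open>0 < c\<close> by (simp add: D_def)

  have int: "set_integrable lebesgue {a<..<b} f" if "f \<in> borel_measurable lebesgue" "\<And>y. \<bar>f y\<bar> \<le> K" for a b K :: real and f :: "real \<Rightarrow> real"
    using that by (intro integrable_lebesgue_AE_bounded[where C=K]) auto
  have v_diff: "\<bar>v y - v' y\<bar> \<le> V + V'" "\<bar>1 / v' y\<bar> \<le> 1 / c" "\<bar>1 / v y\<bar> \<le> 1 / c"
    "\<bar>1 / v' y - 1 / v y\<bar> \<le> \<bar>v y - v' y\<bar> / c\<^sup>2" for y
  proof -
    have pos: "c \<le> v y" "c \<le> v' y" "0 < v y" "0 < v' y"
      using v(2)[of y] v'(2)[of y] \<open>0 < c\<close> by linarith+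
    then show "\<bar>1 / v' y\<bar> \<le> 1 / c" "\<bar>1 / v y\<bar> \<le> 1 / c"
      using \<open>0 < c\<close> by (auto intro!: divide_left_mono)
    show "\<bar>v y - v' y\<bar> \<le> V + V'" using v(3)[of y] v'(3)[of y] pos by linarith
    have "1 / v' y - 1 / v y = (v y - v' y) / (v y * v' y)" using pos by (simp add: field_simps)
    moreover have "c\<^sup>2 \<le> v y * v' y"
      unfolding power2_eq_square using pos \<open>0 < c\<close> by (intro mult_mono) auto
    ultimately show "\<bar>1 / v' y - 1 / v y\<bar> \<le> \<bar>v y - v' y\<bar> / c\<^sup>2"
      using pos \<open>0 < c\<close> by (simp add: abs_mult) (intro divide_left_mono; simp)
  qed
  have speeds_le: "\<bar>(H' q - H' p) - (H q - H p)\<bar> \<le> W / c\<^sup>2" if "p \<le> q" "yl \<le> p" "q \<le> yu" for p q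
  proof -
    note [measurable] = v(1) v'(1)
    have sub: "{p<..<q} \<subseteq> Y" using that Y(1) by auto
    have "H' q - H' p = (LINT y:{p<..<q}|lebesgue. 1 / v' y)" "H q - H p = (LINT y:{p<..<q}|lebesgue. 1 / v y)"
      using H(1)[of p q] H'(1)[of p q] that by (simp_all add: interval_lebesgue_integral_def)
    then have "(H' q - H' p) - (H q - H p) = (LINT y:{p<..<q}|lebesgue. 1 / v' y - 1 / v y)"
      by (subst set_integral_diff(2)) (auto intro!: int[where K="1 / c"] v_diff)
    also have "\<bar>\<dots>\<bar> \<le> (LINT y:{p<..<q}|lebesgue. \<bar>1 / v' y - 1 / v y\<bar>)"
      unfolding set_lebesgue_integral_def using integral_abs_bound
      by (rule order_trans) (simp add: abs_mult)
    also have "\<dots> \<le> (LINT y:{p<..<q}|lebesgue. \<bar>v y - v' y\<bar> / c\<^sup>2)"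
    proof (intro set_integral_mono)
      have "\<bar>1 / v' y - 1 / v y\<bar> \<le> 1 / c + 1 / c" for y
        using v_diff(2,3)[of y] by linarith
      then show "set_integrable lebesgue {p<..<q} (\<lambda>y. \<bar>1 / v' y - 1 / v y\<bar>)"
        by (intro int[where K="1 / c + 1 / c"]) simp_all
      show "set_integrable lebesgue {p<..<q} (\<lambda>y. \<bar>v y - v' y\<bar> / c\<^sup>2)"
        by (intro int[where K="(V + V') / c\<^sup>2"]) (auto intro: divide_right_mono v_diff(1))
    qed (rule v_diff(4))
    also have "\<dots> = (LINT y:{p<..<q}|lebesgue. \<bar>v y - v' y\<bar>) / c\<^sup>2"
      by (simp add: set_lebesgue_integral_def)
    also have "(LINT y:{p<..<q}|lebesgue. \<bar>v y - v' y\<bar>) \<le> W"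
      unfolding W_def set_lebesgue_integral_def
    proof (rule integral_mono)
      show "integrable lebesgue (\<lambda>y. indicat_real {p<..<q} y *\<^sub>R \<bar>v y - v' y\<bar>)"
        "integrable lebesgue (\<lambda>y. indicat_real Y y *\<^sub>R \<bar>v y - v' y\<bar>)"
        using int[of "\<lambda>y. \<bar>v y - v' y\<bar>" "V + V'"] v_diff(1) unfolding Y(1) set_integrable_def by auto
    qed (use sub in \<open>auto simp: indicator_def\<close>)
    finally show ?thesis by (simp add: divide_right_mono)
  qed

  have bridge: "u s \<le> V * \<bar>A s - A' s\<bar> + D" if s: "s \<in> {0..T}" for s
  proof -
    define w where "w = \<bar>A' s\<bar>"
    have "w \<le> T * M'" using A_bound(2)[OF s] by (simp add: w_def)
    have "0 \<le> w" by (simp add: w_def)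
    \<comment> \<open>At a speed of at most \<open>V\<close>, covering the distance V w takes at
      least the time \<open>w\<close>. Hence \<open>H\<close> attains the value H x0 + A' s between
      these two points, and the intermediate value theorem supplies \<open>z\<close>.\<close>
    have lo: "H (x0 - V * w) \<le> H x0 - w" and hi: "H x0 + w \<le> H (x0 + V * w)"
      using H(4)[of "x0 - V * w" x0] H(4)[of x0 "x0 + V * w"] \<open>0 \<le> w\<close> \<open>0 < V\<close> by simp_all
    have "(1 / c)-lipschitz_on UNIV H"
      using H(3) \<open>0 < c\<close> by (intro lipschitz_onI) (auto simp: dist_real_def)
    then have "continuous_on {x0 - V * w..x0 + V * w} H"
      using lipschitz_on_continuous_on continuous_on_subset by blast
    moreover have "H (x0 - V * w) \<le> H x0 + A' s" "H x0 + A' s \<le> H (x0 + V * w)"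
      using lo hi unfolding w_def by linarith+
    ultimately obtain z where z: "x0 - V * w \<le> z" "z \<le> x0 + V * w" "H z = H x0 + A' s"
      using IVT'[of H "x0 - V * w" "H x0 + A' s" "x0 + V * w"] \<open>0 \<le> w\<close> \<open>0 < V\<close> by auto
    have "V * w \<le> T * V * M'"
      using mult_left_mono[OF \<open>w \<le> T * M'\<close>, of V] \<open>0 < V\<close> by (simp add: ac_simps)
    then have z_in: "yl \<le> z" "z \<le> yu" "yl \<le> x0" "x0 \<le> yu" using z Y \<open>0 \<le> w\<close> \<open>0 < V\<close>
      by (smt (verit) mult_nonneg_nonneg)+
    have "\<bar>x s - z\<bar> \<le> V * \<bar>A s - A' s\<bar>"
      using H(2)[of "x s" z] A(1)[OF s] z(3) by (simp add: abs_minus_commute algebra_simps)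
    moreover have "\<bar>z - x' s\<bar> \<le> D"
    proof -
      \<comment> \<open>H z - H x0 and H' (x' s) - H' x0' are the same time \<open>A' s\<close>. So
        H' z - H' (x' s) splits into the error of the speeds between \<open>x0\<close> and
        \<open>z\<close>, and the travel time at speed \<open>v'\<close> between the two starting
        points.\<close>
      have "\<bar>(H' z - H' x0) - (H z - H x0)\<bar> \<le> W / c\<^sup>2"
        using speeds_le[of x0 z] speeds_le[of z x0] z_in by (cases "x0 \<le> z") linarith+
      moreover have "\<bar>H' x0 - H' x0'\<bar> \<le> \<bar>x0 - x0'\<bar> / c" by (rule H'(3))
      ultimately have "\<bar>H' z - H' (x' s)\<bar> \<le> \<bar>x0 - x0'\<bar> / c + W / c\<^sup>2"
        using A(2)[OF s] z(3) by linarith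
      then have "V' * \<bar>H' z - H' (x' s)\<bar> \<le> V' * (\<bar>x0 - x0'\<bar> / c + W / c\<^sup>2)"
        using \<open>0 < V'\<close> by (intro mult_left_mono) auto
      moreover have "V' * (\<bar>x0 - x0'\<bar> / c + W / c\<^sup>2) = D"
        using \<open>0 < c\<close> by (simp add: D_def field_simps power2_eq_square)
      ultimately show ?thesis using H'(2)[of z "x' s"] by linarith
    qed
    ultimately show ?thesis unfolding u_def by linarith
  qed

  have u_cont: "continuous_on S u" for S
    unfolding u_def
    by (intro continuous_intros continuous_on_subset[OF x] continuous_on_subset[OF x']) auto
  have int_u: "set_integrable lebesgue {0<..<s} u" for s
  proof -
    have "u absolutely_integrable_on {0..s}"
      by (intro absolutely_integrable_continuous_real u_cont)
    then show ?thesis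
      by (rule set_integrable_subset) auto
  qed
  have fields: "\<bar>A s - A' s\<bar> \<le> b + L2 * integral {0..s} u" if s: "s \<in> {0..t}" for s
  proof -
    have near: "\<bar>x r - x0\<bar> \<le> T * V * M" if "r \<in> {0..T}" for r
    proof -
      have "\<bar>x r - x0\<bar> \<le> V * \<bar>A r\<bar>" using H(2)[where a=x0 and b="x r"] A(1)[OF that] by simp
      also have "\<dots> \<le> V * (T * M)" using A_bound(1)[OF that] \<open>0 < V\<close> by (intro mult_left_mono) auto
      finally show ?thesis by (simp add: ac_simps)
    qed
    \<comment> \<open>The value \<mu>' r (x r) is inserted: at the common point \<open>x r\<close>
      the fields differ by at most \<open>B r\<close>, and the Lipschitz bound of
      \<open>\<mu>'\<close> covers the change of the point.\<close>
    have le: "\<bar>\<mu> r (x r) - \<mu>' r (x' r)\<bar> \<le> B r + L2 * u r" if "r \<in> {0..T}" for r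
    proof -
      have "\<bar>\<mu>' r (x r) - \<mu>' r (x' r)\<bar> \<le> L' * \<bar>x r - x' r\<bar>"
        using \<mu>' by (simp add: regular_field_def)
      also have "\<dots> \<le> L2 * u r" unfolding u_def using \<open>L' \<le> L2\<close> by (intro mult_right_mono) auto
      finally show ?thesis using B(4)[OF near[OF that], of r] by linarith
    qed
    have int_B: "set_integrable lebesgue {0<..<s} B" for s
      using B(2,3) by (intro int[OF B(1), where K=C]) simp
    have int_\<mu>: "set_integrable lebesgue {0<..<s} (\<lambda>r. \<mu> r (x r))" "set_integrable lebesgue {0<..<s} (\<lambda>r. \<mu>' r (x' r))"
      using \<mu> \<mu>' by (auto intro!: int meas simp: regular_field_def)
    have "A s - A' s = (LINT r:{0<..<s}|lebesgue. \<mu> r (x r) - \<mu>' r (x' r))"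
      unfolding A_def A'_def using int_\<mu> by simp
    also have "\<bar>\<dots>\<bar> \<le> (LINT r:{0<..<s}|lebesgue. \<bar>\<mu> r (x r) - \<mu>' r (x' r)\<bar>)"
      unfolding set_lebesgue_integral_def using integral_abs_bound
      by (rule order_trans) (simp add: abs_mult)
    also have "\<dots> \<le> (LINT r:{0<..<s}|lebesgue. B r + L2 * u r)"
      using s t le by (intro set_integral_mono set_integrable_abs set_integral_diff set_integral_add
          set_integrable_mult_right int_B int_u int_\<mu>) auto
    also have "\<dots> = (LINT r:{0<..<s}|lebesgue. B r) + L2 * (LINT r:{0<..<s}|lebesgue. u r)"
      using int_B int_u by (subst set_integral_add(2)) (auto intro: set_integrable_mult_right)
    also have "(LINT r:{0<..<s}|lebesgue. u r) = integral {0..s} u"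
      using set_lebesgue_integral_eq_integral(2)[OF int_u[of s]] integral_open_interval_real[of 0 s u] by simp
    \<comment> \<open>As \<open>B\<close> is non-negative, the domain can be enlarged to end at
      \<open>t\<close>; this gives Gronwall's inequality a constant independent of
      \<open>s\<close>.\<close>
    also have "(LINT r:{0<..<s}|lebesgue. B r) \<le> b"
      unfolding b_def set_lebesgue_integral_def
      using int_B[unfolded set_integrable_def] s B(2)
      by (intro integral_mono) (auto simp: indicator_def)
    finally show ?thesis by simp
  qed
  have "u s \<le> (D + V * b) + (V * L2) * integral {0..s} u" if "s \<in> {0..t}" for s
  proof -
    have "V * \<bar>A s - A' s\<bar> \<le> V * (b + L2 * integral {0..s} u)"
      using fields[OF that] \<open>0 < V\<close> by (intro mult_left_mono) auto
    then show ?thesis using bridge[of s] that t by (simp add: algebra_simps)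
  qed
  then have "u t \<le> (D + V * b) * exp ((V * L2) * t)"
    using t u_cont \<open>0 < V\<close> \<open>0 \<le> L2\<close> by (intro Gronwall) auto
  also have "\<dots> = V * exp (t * V * L2) * b + exp (t * V * L2) * D"
    by (simp add: algebra_simps)
  also have "exp (t * V * L2) * D \<le> (V * exp (t * V * L2) * t * L2 + 1) * D"
  proof (rule mult_right_mono[OF _ \<open>0 \<le> D\<close>])
    define k where "k = t * V * L2"
    have "1 - k \<le> exp (- k)" using exp_ge_add_one_self[of "- k"] by simp
    then have "(1 - k) * exp k \<le> exp (- k) * exp k" by (intro mult_right_mono) auto
    then have "exp k \<le> k * exp k + 1" by (simp add: algebra_simps flip: exp_add)
    then show "exp (t * V * L2) \<le> V * exp (t * V * L2) * t * L2 + 1" by (simp add: k_def ac_simps)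
  qed
  finally show ?thesis
    using interval_lebesgue_integral_real[OF t(1), of lebesgue B]
    by (simp add: u_def b_def D_def W_def zero_ereal_def mult.assoc)
qed

section \<open>Passage to representatives that are regular everywhere\<close>

lemma interval_integral_cong_AE_lebesgue:
  fixes f g :: "real \<Rightarrow> real" and a b :: real
  assumes g: "g \<in> borel_measurable lebesgue"
    and eq: "AE s in lebesgue. s \<in> {min a b<..<max a b} \<longrightarrow> f s = g s"
  shows "(LINT s=a..b|lebesgue. f s) = (LINT s=a..b|lebesgue. g s)"
proof -
  have *: "(LINT s:S|lebesgue. f s) = (LINT s:S|lebesgue. g s)"
    if "S \<subseteq> {min a b<..<max a b}" "S \<in> sets lebesgue" for S
    unfolding set_lebesgue_integral_def
  proof (rule integral_cong_AE)
    show meas: "(\<lambda>s. indicator S s *\<^sub>R g s) \<in> borel_measurable lebesgue"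
      using g that(2) by (auto intro!: borel_measurable_scaleR)
    have "AE s in lebesgue. indicator S s *\<^sub>R g s = indicator S s *\<^sub>R f s"
      using eq that(1) by (auto elim!: eventually_mono simp: indicator_def)
    then show "AE s in lebesgue. indicator S s *\<^sub>R f s = indicator S s *\<^sub>R g s"
      by eventually_elim (rule sym)
    show "(\<lambda>s. indicator S s *\<^sub>R f s) \<in> borel_measurable lebesgue"
      using meas \<open>AE s in lebesgue. indicator S s *\<^sub>R g s = indicator S s *\<^sub>R f s\<close>
      by (rule borel_measurable_AE)
  qed
  show ?thesis
    unfolding interval_lebesgue_integral_def
    using *[of "{a<..<b}"] *[of "{b<..<a}"] by (cases "a \<le> b") auto
qed

text \<open>\<open>v\<close> is clamped to the interval from \<open>c\<close> to its norm, where
  almost all its values lie. This interval is non-empty because the line is not a null set.\<close>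

lemma Linf_ge_regular_version:
  assumes "v \<in> Linf_ge c"
  obtains w where "w \<in> borel_measurable lebesgue" "\<And>y. c \<le> w y" "\<And>y. w y \<le> Linf_norm UNIV v"
    "AE y in lebesgue. v y = w y"
proof -
  let ?V = "Linf_norm UNIV v"
  have "v \<in> Linf UNIV" and ge: "AE y in lebesgue. c \<le> v y"
    using assms by (auto simp: Linf_ge_def)
  note v = Linf_UNIV_D[OF this(1)]
  note [measurable] = v(1)
  have ae: "AE y in lebesgue. c \<le> v y \<and> v y \<le> ?V"
    using ge v(2) by eventually_elim auto
  have "c \<le> ?V"
  proof (rule ccontr)
    assume less: "\<not> c \<le> ?V"
    from ae have "AE y in lebesgue. y \<notin> (UNIV :: real set)"
      by eventually_elim (use less in auto)
    then have "negligible (UNIV :: real set)"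
      by (simp add: negligible_iff_null_sets AE_iff_null_sets)
    then show False by simp
  qed
  show thesis
  proof (rule that[of "\<lambda>y. max c (min (v y) ?V)"])
    show "AE y in lebesgue. v y = max c (min (v y) ?V)"
      using ae by eventually_elim auto
  qed (use \<open>c \<le> ?V\<close> in auto)
qed

text \<open>For \<open>k\<close> = 0 the image of (-1,1) collapses to the point \<open>x0\<close>,
  and otherwise it is an open interval. In both cases the closure is the closed interval of radius
  \<open>k\<close> about \<open>x0\<close>.\<close>

lemma Xset_cases:
  fixes T x0 :: real and v :: "real \<Rightarrow> real" and lam :: "real \<Rightarrow> real \<Rightarrow> real"
  defines "k \<equiv> T * Linf_norm UNIV v * Linf_Linf_norm T lam"
  assumes "0 < T"
  shows "Xset T x0 v lam = {x0} \<or> open (Xset T x0 v lam) \<and> Xset T x0 v lam \<noteq> {}"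
    and "\<bar>y - x0\<bar> \<le> k \<Longrightarrow> y \<in> closure (Xset T x0 v lam)"
proof -
  have "0 \<le> k"
    using \<open>0 < T\<close> by (simp add: k_def Linf_Linf_norm_def Linf_norm_nonneg)
  have X: "Xset T x0 v lam = (if k = 0 then {x0} else {x0 - k<..<x0 + k})"
  proof (cases "k = 0")
    case True
    have "{-1<..<1::real} \<noteq> {}" by simp
    then have "(\<lambda>r::real. x0) ` {-1<..<1} = {x0}" by (simp only: image_constant_conv if_False)
    with True show ?thesis unfolding Xset_def k_def[symmetric] by simp
  next
    case False
    with \<open>0 \<le> k\<close> have "0 < k" by simp
    have "y \<in> (\<lambda>r. x0 + k * r) ` {-1<..<1}" if "y \<in> {x0 - k<..<x0 + k}" for y
      using that \<open>0 < k\<close> by (intro image_eqI[of _ _ "(y - x0) / k"]) (auto simp: field_simps)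
    moreover have "x0 + k * r \<in> {x0 - k<..<x0 + k}" if "r \<in> {-1<..<1}" for r
      using mult_strict_left_mono[of r 1 k] mult_strict_left_mono[of "-1" r k] that \<open>0 < k\<close> by auto
    ultimately show ?thesis
      using False unfolding Xset_def k_def[symmetric] by auto
  qed
  show "Xset T x0 v lam = {x0} \<or> open (Xset T x0 v lam) \<and> Xset T x0 v lam \<noteq> {}"
    using \<open>0 \<le> k\<close> unfolding X by auto
  show "y \<in> closure (Xset T x0 v lam)" if "\<bar>y - x0\<bar> \<le> k"
    using \<open>0 \<le> k\<close> that unfolding X by (auto simp: abs_le_iff)
qed

theorem theorem2p4:
  fixes T v_low x0 x0' :: real
    and v v' :: "real \<Rightarrow> real"
    and lam lam' :: "real \<Rightarrow> real \<Rightarrow> real"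
    and x x' :: "real \<Rightarrow> real"
    and t :: real
  assumes "T > 0" and "v_low > 0"
    and "v \<in> Linf_ge v_low" and "v' \<in> Linf_ge v_low"
    and "lam \<in> Linf_W1inf T" and "lam' \<in> Linf_W1inf T"
    and "integral_solution T v lam x0 x"
    and "integral_solution T v' lam' x0' x'"
    and "t \<in> {0..T}"
  shows "\<bar>x t - x' t\<bar> \<le>
      Linf_norm UNIV v * exp (t * Linf_norm UNIV v * Lcal2 T lam lam') *
        (LINT s=0..t|lebesgue. sup_norm_on (Xset T x0 v lam) (\<lambda>y. lam s y - lam' s y))
    + (Linf_norm UNIV v * exp (t * Linf_norm UNIV v * Lcal2 T lam lam') * t * Lcal2 T lam lam' + 1) *
        (Linf_norm UNIV v' / v_low) *
        (\<bar>x0 - x0'\<bar> + 1 / v_low * L1_norm (Yset T x0 x0' v (Lcal T lam lam')) (\<lambda>y. v y - v' y))"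
proof -
  obtain w where w: "w \<in> borel_measurable lebesgue" "\<And>y. v_low \<le> w y" "\<And>y. w y \<le> Linf_norm UNIV v"
    "AE y in lebesgue. v y = w y"
    by (rule Linf_ge_regular_version[OF assms(3)]) blast
  obtain w' where w': "w' \<in> borel_measurable lebesgue" "\<And>y. v_low \<le> w' y" "\<And>y. w' y \<le> Linf_norm UNIV v'"
    "AE y in lebesgue. v' y = w' y"
    by (rule Linf_ge_regular_version[OF assms(4)]) blast
  obtain \<mu> where \<mu>: "regular_field \<mu> (Linf_Linf_norm T lam) (Linf_Linf_norm T (partial2 lam))"
    and \<mu>_eq: "AE s in lebesgue. s \<in> {0<..<T} \<longrightarrow> \<mu> s = lam s"
    by (rule Linf_W1inf_regular_version[OF assms(5)])
  obtain \<mu>' where \<mu>': "regular_field \<mu>' (Linf_Linf_norm T lam') (Linf_Linf_norm T (partial2 lam'))"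
    and \<mu>'_eq: "AE s in lebesgue. s \<in> {0<..<T} \<longrightarrow> \<mu>' s = lam' s"
    by (rule Linf_W1inf_regular_version[OF assms(6)])
  \<comment> \<open>Continuing the solutions by constants outside [0,T] makes them continuous on the
    whole line, as \<open>regular_field_Caratheodory\<close> demands; on [0,T] nothing
    changes.\<close>
  define clamp where "clamp s = max 0 (min T s)" for s
  have clamp: "clamp s = s" if "s \<in> {0..T}" for s using that by (auto simp: clamp_def)
  have clamp_cont: "continuous_on UNIV (\<lambda>s. f (clamp s))" if "continuous_on {0..T} f" for f :: "real \<Rightarrow> real"
    unfolding clamp_def using that \<open>T > 0\<close>
    by (intro continuous_on_compose2[OF that] continuous_intros) auto
  have x: "continuous_on UNIV (\<lambda>s. x (clamp s))" and x': "continuous_on UNIV (\<lambda>s. x' (clamp s))"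
    using assms(7,8) by (auto simp: integral_solution_def intro!: clamp_cont)
  \<comment> \<open>Stated for arbitrary data, to serve both solutions: the integral equation
    survives changes of the speed, and of the field in time, on null sets.\<close>
  have sol: "(LINT y=x0..f s|lebesgue. (1 / w y)) = (LINT r=0..s|lebesgue. \<mu> r (f (clamp r)))"
    if "integral_solution T v lam x0 f" "s \<in> {0..T}" and v: "w \<in> borel_measurable lebesgue" "AE y in lebesgue. v y = w y"
      and \<mu>: "regular_field \<mu> M L" "AE s in lebesgue. s \<in> {0<..<T} \<longrightarrow> \<mu> s = lam s"
    for v w lam x0 f s \<mu> M L
  proof -
    have f: "continuous_on UNIV (\<lambda>s. f (clamp s))"
      using that(1) by (auto simp: integral_solution_def intro!: clamp_cont)
    note [measurable] = v(1)
    have "(LINT y=x0..f s|lebesgue. (1 / v y)) = (LINT y=x0..f s|lebesgue. (1 / w y))"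
      using v(2) by (intro interval_integral_cong_AE_lebesgue) (auto elim!: eventually_mono)
    moreover have "(LINT r=ereal 0..ereal s|lebesgue. lam r (f r)) = (LINT r=ereal 0..ereal s|lebesgue. \<mu> r (f (clamp r)))"
    proof (rule interval_integral_cong_AE_lebesgue)
      show "(\<lambda>r. \<mu> r (f (clamp r))) \<in> borel_measurable lebesgue"
        by (rule regular_field_Caratheodory[OF \<mu>(1) f])
      show "AE r in lebesgue. r \<in> {min 0 s<..<max 0 s} \<longrightarrow> lam r (f r) = \<mu> r (f (clamp r))"
        using \<mu>(2) by eventually_elim (use that(2) in \<open>auto simp: clamp\<close>)
    qed
    ultimately show ?thesis
      using that(1,2) unfolding integral_solution_def zero_ereal_def by simp
  qed
  define X where "X = Xset T x0 v lam"
  define B where "B s = sup_norm_on X (\<lambda>y. \<mu> s y - \<mu>' s y)" for s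
  note X = Xset_cases[OF \<open>T > 0\<close>, where ?x0.0=x0 and v=v and lam=lam, folded X_def]
  note B = sup_norm_on_regular[OF \<mu> \<mu>' X(1), folded B_def]
  \<comment> \<open>At almost every time the fields and their regular versions agree at all points,
    so the suprema agree even if \<open>X\<close> is a single point.\<close>
  have sup_eq: "(LINT s=ereal 0..ereal t|lebesgue. B s) =
      (LINT s=ereal 0..ereal t|lebesgue. sup_norm_on X (\<lambda>y. lam s y - lam' s y))"
  proof (rule interval_integral_cong_AE_lebesgue[symmetric])
    show "AE s in lebesgue. s \<in> {min 0 t<..<max 0 t} \<longrightarrow> sup_norm_on X (\<lambda>y. lam s y - lam' s y) = B s"
      using \<mu>_eq \<mu>'_eq by eventually_elim (use assms(9) in \<open>auto simp: B_def\<close>)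
  qed (rule B(1))
  define Y where "Y = Yset T x0 x0' v (Lcal T lam lam')"
  have L1: "L1_norm Y (\<lambda>y. v y - v' y) = (LINT y:Y|lebesgue. \<bar>w y - w' y\<bar>)"
  proof -
    have [measurable]: "v \<in> borel_measurable lebesgue" "v' \<in> borel_measurable lebesgue"
      using assms(3,4) by (auto simp: Linf_ge_def intro: Linf_UNIV_D)
    note [measurable] = w(1) w'(1)
    have [measurable]: "Y \<in> sets lebesgue" by (simp add: Y_def Yset_def)
    show ?thesis
      unfolding L1_norm_def set_lebesgue_integral_def
    proof (rule integral_cong_AE)
      show "AE y in lebesgue. indicat_real Y y *\<^sub>R \<bar>v y - v' y\<bar> = indicat_real Y y *\<^sub>R \<bar>w y - w' y\<bar>"
        using w(4) w'(4) by eventually_elim simp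
    qed measurable
  qed
  have norms_nonneg: "0 \<le> T * Linf_norm UNIV v" using \<open>T > 0\<close> by (simp add: Linf_norm_nonneg)
  \<comment> \<open>\<open>Y\<close> is built with \<open>Lcal\<close>, which dominates the norm of
    \<open>lam'\<close>, so it contains the interval required by
    \<open>regular_solutions_stability\<close>.\<close>
  have TVM: "T * Linf_norm UNIV v * Linf_Linf_norm T lam' \<le> T * Linf_norm UNIV v * Lcal T lam lam'"
    using norms_nonneg by (intro mult_left_mono) (auto simp: Lcal_def)
  have "\<bar>x (clamp t) - x' (clamp t)\<bar> \<le>
      Linf_norm UNIV v * exp (t * Linf_norm UNIV v * Lcal2 T lam lam') * (LINT s=0..t|lebesgue. B s)
    + (Linf_norm UNIV v * exp (t * Linf_norm UNIV v * Lcal2 T lam lam') * t * Lcal2 T lam lam' + 1) *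
        (Linf_norm UNIV v' / v_low) *
        (\<bar>x0 - x0'\<bar> + 1 / v_low * (LINT y:Y|lebesgue. \<bar>w y - w' y\<bar>))"
  proof (rule regular_solutions_stability[OF \<open>v_low > 0\<close> _ _ w(1-3) w'(1-3) \<mu> \<mu>' x x'])
    show "0 \<le> t" "t \<le> T" using assms(9) by auto
    fix s assume s: "s \<in> {0..T}"
    show "(LINT y=x0..x (clamp s)|lebesgue. (1 / w y)) = (LINT r=0..s|lebesgue. \<mu> r (x (clamp r)))"
      unfolding clamp[OF s] by (rule sol[OF assms(7) s w(1,4) \<mu> \<mu>_eq])
    show "(LINT y=x0'..x' (clamp s)|lebesgue. (1 / w' y)) = (LINT r=0..s|lebesgue. \<mu>' r (x' (clamp r)))"
      unfolding clamp[OF s] by (rule sol[OF assms(8) s w'(1,4) \<mu>' \<mu>'_eq])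
  next
    show "Linf_Linf_norm T (partial2 lam') \<le> Lcal2 T lam lam'" by (simp add: Lcal2_def)
    show "0 \<le> Lcal2 T lam lam'"
      by (simp add: Lcal2_def Linf_Linf_norm_def Linf_norm_nonneg le_max_iff_disj)
    show "Y = {min (x0 - T * Linf_norm UNIV v * Lcal T lam lam') x0' <..<
        max (x0 + T * Linf_norm UNIV v * Lcal T lam lam') x0'}" by (simp add: Y_def Yset_def)
  qed (use B X(2) TVM in \<open>auto simp: min_le_iff_disj le_max_iff_disj\<close>)
  then show ?thesis
    using clamp[OF assms(9)] sup_eq L1 unfolding X_def Y_def zero_ereal_def by simp
qed

end
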